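(* Let $b\ge2$ and $n\ge1$. The number $N'(b,n)$ of prime $b$-ball juggling patterns of period $n$ satisfies $$N'(b,n)\ge\frac1b\sum_{t\ge1}\sum_{\substack{p_1>\cdots>p_t\ge1\\ p_1+\cdots+p_t=n}}\frac{(b-1)^n}{\binom{t+b-1}{b}}\prod_{i=1}^t\left(\frac{i+b-1}{i+b-2}\right)^{p_i}.$$
   Context: A $b$-ball juggling state is a sequence $\alpha=(\alpha_1,\alpha_2,\dots)$ with $\alpha_i\in\{0,1\}$, finitely many nonzero, and $\sum_i\alpha_i=b$ ($\alpha_i=1$ means a ball lands $i$ beats from now). There is a transition $\alpha\to\beta$ iff $\alpha_{i+1}\le\beta_i$ for all $i\ge1$. A prime $b$-ball juggling pattern of period $n$ is a directed cycle of length $n$ in this (infinite) state graph, i.e. a closed walk of length $n$ visiting $n$ distinct states, counted up to cyclic rotation. *)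

theory Defs
  imports Complex_Main
begin

(* Sequences are indexed from 0: the value at i is alpha_(i+1) in the usual 1-based numbering,
   i.e. it tells whether a ball lands i + 1 beats from now. *)
definition juggling_state :: "nat \<Rightarrow> (nat \<Rightarrow> nat) \<Rightarrow> bool" where
  "juggling_state b \<alpha> \<longleftrightarrow>
     (\<forall>i. \<alpha> i \<in> {0, 1}) \<and> finite {i. \<alpha> i \<noteq> 0} \<and> (\<Sum>i | \<alpha> i \<noteq> 0. \<alpha> i) = b"

definition transition :: "(nat \<Rightarrow> nat) \<Rightarrow> (nat \<Rightarrow> nat) \<Rightarrow> bool" where
  "transition \<alpha> \<beta> \<longleftrightarrow> (\<forall>i. \<alpha> (Suc i) \<le> \<beta> i)"

(* The graph has no parallel edges, so a closed walk of length n is given by the list of its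
   n successive vertices; the last vertex has an edge back to the first.  For n = 1 this is a loop. *)
definition rooted_cycles :: "nat \<Rightarrow> nat \<Rightarrow> (nat \<Rightarrow> nat) list set" where
  "rooted_cycles b n =
     {ss. length ss = n \<and> distinct ss \<and> (\<forall>\<alpha>\<in>set ss. juggling_state b \<alpha>) \<and>
          (\<forall>k<n. transition (ss ! k) (ss ! (Suc k mod n)))}"

definition rotation_rel :: "'a list set \<Rightarrow> ('a list \<times> 'a list) set" where
  "rotation_rel C = {(xs, ys). xs \<in> C \<and> ys \<in> C \<and> (\<exists>k. ys = rotate k xs)}"

definition prime_patterns :: "nat \<Rightarrow> nat \<Rightarrow> (nat \<Rightarrow> nat) list set set" where
  "prime_patterns b n = rooted_cycles b n // rotation_rel (rooted_cycles b n)"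

definition num_prime_patterns :: "nat \<Rightarrow> nat \<Rightarrow> nat" where
  "num_prime_patterns b n = card (prime_patterns b n)"

(* Lists [p_1, ..., p_t] with p_1 > ... > p_t \<ge> 1 and p_1 + ... + p_t = n.
   There are none for t > n. *)
definition strict_partitions :: "nat \<Rightarrow> nat \<Rightarrow> nat list set" where
  "strict_partitions n t =
     {p. length p = t \<and> sorted_wrt (>) p \<and> (\<forall>x\<in>set p. 1 \<le> x) \<and> sum_list p = n}"

end

theory Submission
  imports Defs "HOL-Combinatorics.Permutations" "HOL-Library.FuncSet"
begin

text \<open>
  Label each time x with the number of airborne balls, the thrown one included, that land no later
  than x at the moment when the ball landing at x is thrown, and with 0 if nothing lands at x.  Any
  n-periodic labelling r with values in {0..b} that takes the value b arises in this way.  In every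
  state the two balls landing last are at times m < L, where r m is b - 1 or b and L is the first
  time after m with label b.  Hence the states of a period are pairwise distinct as soon as the
  distances L - m differ for all m (modulo n) with label at least b - 1.  Cut the period in front of
  each label b and align the resulting blocks at their right ends: the condition says that in each
  column at most one block has a label at least b - 1.  In particular the block lengths are distinct
  and form a strict partition p of n.  The blocks have (t - 1)! cyclic arrangements, and a column
  with j rows can be filled in (b - 1)^(j - 1) ways if one of the blocks starts there and in
  (b - 1)^(j - 1) (j + b - 1) ways otherwise; the product of these numbers is the summand for p.
\<close>

subsection \<open>The states of a labelling\<close>

text \<open>A relation in \<open>d\<close> rather than a least element, so that gaps can be read off
  from blocks directly.\<close>

definition gap :: "nat \<Rightarrow> (nat \<Rightarrow> nat) \<Rightarrow> nat \<Rightarrow> nat \<Rightarrow> bool" where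
  "gap b r m d \<longleftrightarrow> 0 < d \<and> r (m + d) = b \<and> (\<forall>e. 0 < e \<and> e < d \<longrightarrow> r (m + e) \<noteq> b)"

text \<open>Time runs over the naturals, so later definitions only look forward. The recurrence of
  the label \<open>b\<close> makes each such search end, and periodicity replaces the missing
  past.\<close>

locale landing_labels =
  fixes b n :: nat and r :: "nat \<Rightarrow> nat"
  assumes n_pos: "0 < n" and b_ge2: "2 \<le> b"
    and label_le: "r x \<le> b" and periodic: "r (x + n) = r x" and top_ex: "\<exists>x. r x = b"
begin

lemma periodic_mult: "r (x + q * n) = r x"
proof (induction q)
  case (Suc q)
  have "r (x + Suc q * n) = r ((x + q * n) + n)" by (simp add: algebra_simps)
  then show ?case using Suc periodic by simp
qed simp

lemma less_add_period: "s < x + Suc s * n"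
proof -
  have "s < Suc s * 1" by simp
  also have "\<dots> \<le> Suc s * n" by (rule mult_le_mono2) (use n_pos in simp)
  also have "\<dots> \<le> x + Suc s * n" by (rule le_add2)
  finally show ?thesis .
qed

lemma ex_top_after: "\<exists>u>s. r u = b"
proof -
  obtain x where "r x = b" using top_ex by blast
  then have "r (x + Suc s * n) = b" using periodic_mult[of x "Suc s"] by metis
  moreover have "s < x + Suc s * n" using less_add_period by blast
  ultimately show ?thesis by blast
qed

section \<open>Positions of the balls in the air\<close>

definition next_ge :: "nat \<Rightarrow> nat \<Rightarrow> nat" where
  "next_ge j s = (LEAST u. s < u \<and> j \<le> r u)"

lemma next_ge: assumes "j \<le> b" shows "s < next_ge j s" "j \<le> r (next_ge j s)"
proof -
  have "\<exists>u. s < u \<and> j \<le> r u" using ex_top_after[of s] assms by auto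
  from LeastI_ex[OF this] show "s < next_ge j s" "j \<le> r (next_ge j s)"
    by (simp_all add: next_ge_def)
qed

lemma next_ge_Suc:
  assumes "j \<le> b"
  shows "next_ge j s = (if j \<le> r (Suc s) then Suc s else next_ge j (Suc s))"
proof (cases "j \<le> r (Suc s)")
  case True
  then show ?thesis unfolding next_ge_def by (auto intro!: Least_equality)
next
  case False
  have "(s < u \<and> j \<le> r u) = (Suc s < u \<and> j \<le> r u)" for u
    using False by (metis Suc_lessD Suc_lessI)
  then show ?thesis using False unfolding next_ge_def by simp
qed

text \<open>
  slot j s is the landing time of the ball that, among those in the air just after time s, is the
  j-th most recently thrown one.  Seen backwards in time, throws and landings swap roles and a label
  k inserts its ball at position k of this list.
\<close>

primrec slot_aux :: "nat \<Rightarrow> nat \<Rightarrow> nat" where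
  "slot_aux 0 s = next_ge b s"
| "slot_aux (Suc i) s =
     (let u = next_ge (b - Suc i) s in if r u = b - Suc i then u else slot_aux i u)"

text \<open>The recursion pushes \<open>j\<close> up towards \<open>b\<close>, hence the primitive
  recursion on \<open>b - j\<close>. Position 0 stands for the throw of the coming beat; the balls
  already in the air have the positions 1 to \<open>b\<close>.\<close>

definition slot :: "nat \<Rightarrow> nat \<Rightarrow> nat" where
  "slot j s = slot_aux (b - j) s"

lemma slot_top: "slot b s = next_ge b s"
  by (simp add: slot_def)

lemma slot_rec:
  assumes "j < b"
  shows "slot j s = (let u = next_ge j s in if r u = j then u else slot (Suc j) u)"
proof -
  have 1: "b - j = Suc (b - Suc j)" and 2: "b - Suc (b - Suc j) = j" using assms by auto
  show ?thesis unfolding slot_def 1 slot_aux.simps 2 by (simp add: Let_def)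
qed

text \<open>This lemma and the next two describe one beat: the ball in position
  \<open>r (Suc s)\<close> lands and its new throw enters in front, so lower positions move up by
  one and higher ones stay.\<close>

lemma slot_eq_Suc: assumes "j \<le> b" "r (Suc s) = j" shows "slot j s = Suc s"
  using assms slot_rec[of j s] slot_top[of s] next_ge_Suc[of j s]
  by (cases "j = b") (auto simp: Let_def)

lemma slot_high: assumes "j \<le> b" "r (Suc s) < j" shows "slot j s = slot j (Suc s)"
  using assms slot_rec[of j s] slot_rec[of j "Suc s"] slot_top next_ge_Suc[of j s]
  by (cases "j = b") (auto simp: Let_def)

lemma slot_low: assumes "j < r (Suc s)" shows "slot j s = slot (Suc j) (Suc s)"
  using assms slot_rec[of j s] next_ge_Suc[of j s] label_le[of "Suc s"]
  by (auto simp: Let_def)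

lemma slot_gt: "j \<le> b \<Longrightarrow> s < slot j s"
proof (induction "b - j" arbitrary: j s)
  case 0
  then show ?case using next_ge(1)[of b s] slot_top by (simp add: antisym)
next
  case (Suc i)
  then have "j < b" by simp
  have "next_ge j s < slot (Suc j) (next_ge j s)" using Suc by simp
  then show ?case using slot_rec[OF \<open>j < b\<close>, of s] next_ge(1)[of j s] \<open>j < b\<close>
    by (auto simp: Let_def intro: less_trans)
qed

text \<open>Follows one ball beat by beat until it lands. Its landing time stays fixed while
  \<open>s\<close> grows, so the remaining flight time \<open>slot j s - s\<close>
  decreases.\<close>

lemma slot_induct [consumes 1, case_names eq high low]:
  assumes "j \<le> b"
    and eq: "\<And>s j. j \<le> b \<Longrightarrow> r (Suc s) = j \<Longrightarrow> slot j s = Suc s \<Longrightarrow> P j s"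
    and high: "\<And>s j. j \<le> b \<Longrightarrow> r (Suc s) < j \<Longrightarrow> slot j s = slot j (Suc s) \<Longrightarrow>
      P j (Suc s) \<Longrightarrow> P j s"
    and low: "\<And>s j. j < r (Suc s) \<Longrightarrow> r (Suc s) \<le> b \<Longrightarrow> slot j s = slot (Suc j) (Suc s) \<Longrightarrow>
      P (Suc j) (Suc s) \<Longrightarrow> P j s"
  shows "P j s"
  using assms(1)
proof (induction "slot j s - s" arbitrary: j s rule: less_induct)
  case less
  consider "r (Suc s) = j" | "r (Suc s) < j" | "j < r (Suc s)" by linarith
  then show ?case
  proof cases
    case 1
    then show ?thesis using eq less.prems slot_eq_Suc by blast
  next
    case 2
    have "P j (Suc s)" using less slot_high[OF less.prems 2] slot_gt[OF less.prems, of s] by simp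
    then show ?thesis using high less.prems 2 slot_high by blast
  next
    case 3
    have "slot j s = slot (Suc j) (Suc s)" "Suc j \<le> b"
      using slot_low[OF 3] 3 label_le[of "Suc s"] by simp_all
    then have "P (Suc j) (Suc s)" using less slot_gt[OF less.prems, of s] by simp
    then show ?thesis using low 3 label_le slot_low by blast
  qed
qed

lemma Suc_less_slot:
  assumes "j \<le> b" "r (Suc s) \<noteq> j"
  shows "Suc s < slot j s"
  using assms slot_high[of j s] slot_low[of j s] slot_gt[of j "Suc s"] slot_gt[of "Suc j" "Suc s"]
    label_le[of "Suc s"] by (cases "r (Suc s) < j") auto

text \<open>One beat changes the positions of the balls that do not land injectively, and only one
  position lands at that beat. Following \<open>j\<close> to its landing therefore keeps distinct
  positions apart.\<close>

lemma slot_inj: "j \<le> b \<Longrightarrow> i \<le> b \<Longrightarrow> slot i s = slot j s \<Longrightarrow> i = j"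
proof (induction j s arbitrary: i rule: slot_induct)
  case (eq s j)
  then show ?case using Suc_less_slot[of i s] by (cases "r (Suc s) = i") auto
next
  case (high s j)
  show ?case
  proof (cases "r (Suc s) < i")
    case True
    then show ?thesis using high slot_high[of i s] by simp
  next
    case False
    then have le: "i \<le> r (Suc s)" by simp
    show ?thesis
    proof (cases "i = r (Suc s)")
      case True
      then have "slot i s = Suc s" using high.prems(1) slot_eq_Suc by simp
      moreover have "Suc s < slot j (Suc s)" using high.hyps(1) by (rule slot_gt)
      ultimately show ?thesis using high.hyps(3) high.prems(2) by simp
    next
      case False
      then have "i < r (Suc s)" using le by simp
      then have "slot (Suc i) (Suc s) = slot j (Suc s)" "Suc i \<le> b"
        using high.hyps(3) high.prems(2) slot_low[of i s] label_le[of "Suc s"] by simp_all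
      then have "Suc i = j" using high.IH by blast
      then show ?thesis using high.hyps(2) \<open>i < r (Suc s)\<close> by simp
    qed
  qed
next
  case (low s j)
  show ?case
  proof (cases "r (Suc s) < i")
    case True
    then have "slot i (Suc s) = slot (Suc j) (Suc s)"
      using low.hyps(3) low.prems slot_high[of i s] by simp
    then have "i = Suc j" using low.IH low.prems(1) by blast
    then show ?thesis using True low.hyps(1) by simp
  next
    case False
    then have le: "i \<le> r (Suc s)" by simp
    show ?thesis
    proof (cases "i = r (Suc s)")
      case True
      then have "slot i s = Suc s" using low.prems(1) slot_eq_Suc by simp
      moreover have "Suc s < slot (Suc j) (Suc s)" using low.hyps(1,2) by (intro slot_gt) simp
      ultimately show ?thesis using low.hyps(3) low.prems(2) by simp
    next
      case False
      then have "slot (Suc i) (Suc s) = slot (Suc j) (Suc s)" "Suc i \<le> b"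
        using le low.hyps(3) low.prems(2) slot_low[of i s] label_le[of "Suc s"] by simp_all
      then have "Suc i = Suc j" using low.IH by blast
      then show ?thesis by simp
    qed
  qed
qed

lemma slot_add_period: "j \<le> b \<Longrightarrow> slot j (s + n) = slot j s + n"
proof (induction j s rule: slot_induct)
  case (eq s j)
  then show ?case using slot_eq_Suc[of j "s + n"] periodic[of "Suc s"] by simp
next
  case (high s j)
  then show ?case using slot_high[of j "s + n"] periodic[of "Suc s"] by simp
next
  case (low s j)
  then show ?case using slot_low[of j "s + n"] periodic[of "Suc s"] by simp
qed

section \<open>The set of pending landing times\<close>

definition slots :: "nat \<Rightarrow> nat set" where
  "slots s = (\<lambda>j. slot j s) ` {1..b}"

lemma finite_slots: "finite (slots s)"
  by (simp add: slots_def)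

lemma card_slots: "card (slots s) = b"
  unfolding slots_def by (subst card_image) (auto simp: inj_on_def intro: slot_inj)

lemma slots_gt: "x \<in> slots s \<Longrightarrow> s < x"
  by (auto simp: slots_def intro: slot_gt)

lemma Suc_in_slots: "Suc s \<in> slots s \<longleftrightarrow> 0 < r (Suc s)"
proof
  assume "Suc s \<in> slots s"
  then obtain j where "j \<in> {1..b}" "slot j s = Suc s" by (auto simp: slots_def)
  then show "0 < r (Suc s)" using Suc_less_slot[of j s] by (cases "r (Suc s) = j") auto
next
  assume "0 < r (Suc s)"
  then show "Suc s \<in> slots s"
    using slot_eq_Suc[of "r (Suc s)" s] label_le[of "Suc s"]
    by (auto simp: slots_def intro!: image_eqI[of _ _ "r (Suc s)"])
qed

lemma slots_subset: "slots s - {Suc s} \<subseteq> slots (Suc s)"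
proof
  fix x assume "x \<in> slots s - {Suc s}"
  then obtain j where j: "j \<in> {1..b}" "slot j s = x" "x \<noteq> Suc s" by (auto simp: slots_def)
  consider "r (Suc s) < j" | "j < r (Suc s)"
    using j slot_eq_Suc[of j s] by (cases "r (Suc s)" j rule: linorder_cases) auto
  then show "x \<in> slots (Suc s)"
  proof cases
    case 1
    then show ?thesis using j slot_high[of j s] by (auto simp: slots_def)
  next
    case 2
    then show ?thesis using j slot_low[of j s] label_le[of "Suc s"]
      by (auto simp: slots_def intro!: image_eqI[of _ _ "Suc j"])
  qed
qed

text \<open>Traced back one beat, a position \<open>j > 1\<close> comes from \<open>j\<close> or
  from \<open>j - 1\<close>, both at least 1; so only position 1 can hold a ball that was not in the
  air before.\<close>

lemma new_slot:
  assumes "x \<in> slots (Suc s)" "x \<notin> slots s"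
  shows "x = slot 1 (Suc s)"
proof -
  obtain j where j: "j \<in> {1..b}" "slot j (Suc s) = x" using assms by (auto simp: slots_def)
  show ?thesis
  proof (rule ccontr)
    assume "x \<noteq> slot 1 (Suc s)"
    then have "j > 1" using j by (cases "j = 1") auto
    show False
    proof (cases "r (Suc s) < j")
      case True
      then show False using slot_high[of j s] j assms(2) by (auto simp: slots_def)
    next
      case False
      then have "slot (j - 1) s = x" using slot_low[of "j - 1" s] \<open>j > 1\<close> j by simp
      moreover have "j - 1 \<in> {1..b}" using j \<open>j > 1\<close> by auto
      ultimately show False using assms(2) by (auto simp: slots_def)
    qed
  qed
qed

text \<open>
  The label of a ball is determined by the number of balls that were thrown before it and land after
  it, which does not change while it is in the air.
\<close>

definition higher :: "nat \<Rightarrow> nat \<Rightarrow> nat set" where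
  "higher j s = {y. \<exists>i. j < i \<and> i \<le> b \<and> y = slot i s \<and> slot j s < y}"

lemma card_higher: "j \<le> b \<Longrightarrow> card (higher j s) = b - r (slot j s)"
proof (induction j s rule: slot_induct)
  case (eq s j)
  \<comment> \<open>Ball \<open>j\<close> lands at this very beat, before all others, so every
    higher position counts.\<close>
  have "higher j s = (\<lambda>i. slot i s) ` {j<..b}"
    using eq Suc_less_slot[of _ s] by (auto simp: higher_def)
  moreover have "inj_on (\<lambda>i. slot i s) {j<..b}" by (auto simp: inj_on_def intro: slot_inj)
  ultimately show ?case using eq by (simp add: card_image)
next
  case (high s j)
  have "higher j s = higher j (Suc s)"
    using high slot_high[of _ s] by (auto simp: higher_def)
  then show ?case using high by simp
next
  case (low s j)
  have "higher j s = higher (Suc j) (Suc s)"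
  proof (intro equalityI subsetI)
    fix y assume "y \<in> higher j s"
    then obtain i where i: "j < i" "i \<le> b" "y = slot i s" "slot j s < y" by (auto simp: higher_def)
    consider "i < r (Suc s)" | "i = r (Suc s)" | "r (Suc s) < i" by linarith
    then show "y \<in> higher (Suc j) (Suc s)"
    proof cases
      case 1
      then have "y = slot (Suc i) (Suc s)" using i slot_low by simp
      moreover have "Suc i \<le> b" using 1 label_le[of "Suc s"] by simp
      ultimately show ?thesis using i(1,4) low(3) unfolding higher_def
        by (intro CollectI exI[of _ "Suc i"]) simp
    next
      case 2
      \<comment> \<open>Such a ball lands at the coming beat, before ball \<open>j\<close>, which
        contradicts the choice of \<open>y\<close>.\<close>
      then have "y = Suc s" using i slot_eq_Suc by simp
      then show ?thesis using i low slot_gt[of "Suc j" "Suc s"] by simp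
    next
      case 3
      then have "y = slot i (Suc s)" using i slot_high by simp
      moreover have "Suc j < i" using 3 low by simp
      ultimately show ?thesis using i low(3) unfolding higher_def by auto
    qed
  next
    fix y assume "y \<in> higher (Suc j) (Suc s)"
    then obtain i where i: "Suc j < i" "i \<le> b" "y = slot i (Suc s)" "slot j s < y"
      using low by (auto simp: higher_def)
    show "y \<in> higher j s"
    proof (cases "r (Suc s) < i")
      case True
      then have "y = slot i s" using i slot_high by simp
      then show ?thesis using i(1,2,4) unfolding higher_def
        by (intro CollectI exI[of _ i]) simp
    next
      case False
      then have "y = slot (i - 1) s" using slot_low[of "i - 1" s] i by simp
      moreover have "j < i - 1" "i - 1 \<le> b" using i by auto
      ultimately show ?thesis using i unfolding higher_def by blast
    qed
  qed
  then show ?case using low by simp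
qed

text \<open>All other balls are older than the one in position 1, so \<open>higher 1 s\<close>
  consists of all balls landing later. Thus the label of a throw is visible in the state right after
  it.\<close>

lemma label_new_slot: "r (slot 1 s) = b - card {y \<in> slots s. slot 1 s < y}"
proof -
  have "{y \<in> slots s. slot 1 s < y} = higher 1 s"
  proof (intro equalityI subsetI)
    fix y assume "y \<in> {y \<in> slots s. slot 1 s < y}"
    then obtain j where j: "j \<in> {1..b}" "y = slot j s" "slot 1 s < y" by (auto simp: slots_def)
    then have "1 < j" by (cases "j = 1") auto
    then show "y \<in> higher 1 s" using j by (auto simp: higher_def)
  qed (auto simp: higher_def slots_def)
  then show ?thesis using card_higher[of 1 s] b_ge2 label_le[of "slot 1 s"] by simp
qed

text \<open>A ball landing with label \<open>b\<close> is in position \<open>b\<close>, hence the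
  oldest in the air. If it lands before ball \<open>j\<close>, it was thrown before ball
  \<open>j\<close> and is already in the air at time \<open>s\<close>.\<close>

lemma tops_below:
  "j \<le> b \<Longrightarrow> r (slot j s) = b \<Longrightarrow> s < l \<Longrightarrow> l < slot j s \<Longrightarrow> r l = b \<Longrightarrow> \<exists>i>j. i \<le> b \<and> slot i s = l"
proof (induction j s rule: slot_induct)
  case (eq s j)
  then show ?case by simp
next
  case (high s j)
  show ?case
  proof (cases "l = Suc s")
    case True
    then show ?thesis using high by simp
  next
    case False
    then obtain i where "i > j" "i \<le> b" "slot i (Suc s) = l" using high by auto
    then show ?thesis using high slot_high[of i s] by auto
  qed
next
  case (low s j)
  show ?case
  proof (cases "l = Suc s")
    case True
    then show ?thesis using low slot_eq_Suc[of b s] by (intro exI[of _ b]) auto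
  next
    case False
    then obtain i where i: "i > Suc j" "i \<le> b" "slot i (Suc s) = l" using low by auto
    show ?thesis
    proof (cases "r (Suc s) < i")
      case True
      then show ?thesis using i slot_high[of i s] by (intro exI[of _ i]) auto
    next
      case False
      then show ?thesis using i slot_low[of "i - 1" s] by (intro exI[of _ "i - 1"]) auto
    qed
  qed
qed

text \<open>No older ball lands after \<open>L\<close>, so \<open>L\<close> has label
  \<open>b\<close>; at most one, namely \<open>L\<close>, lands after \<open>m\<close>, so
  \<open>m\<close> has label at least \<open>b - 1\<close>. A label \<open>b\<close> strictly
  between them would by \<open>tops_below\<close> belong to a ball in the air, against the choice of
  \<open>m\<close>.\<close>

lemma top_two:
  assumes L: "L \<in> slots s" "\<And>x. x \<in> slots s \<Longrightarrow> x \<le> L"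
    and m: "m \<in> slots s" "m \<noteq> L" "\<And>x. x \<in> slots s \<Longrightarrow> x \<noteq> L \<Longrightarrow> x \<le> m"
  shows "b - 1 \<le> r m" "gap b r m (L - m)"
proof -
  obtain j where j: "j \<in> {1..b}" "L = slot j s" using L by (auto simp: slots_def)
  obtain i where i: "i \<in> {1..b}" "m = slot i s" using m by (auto simp: slots_def)
  have sub: "higher k s \<subseteq> slots s" if "k \<ge> 1" for k using that by (auto simp: higher_def slots_def)
  have "higher j s = {}" using L j sub[of j] by (fastforce simp: higher_def)
  then have rL: "r L = b" using card_higher[of j s] j label_le[of L] by simp
  have "higher i s \<subseteq> {L}"
    using m(3) i sub[of i] by (fastforce simp: higher_def)
  then have "card (higher i s) \<le> 1" by (metis card_mono finite.emptyI finite_insert is_singletonI is_singleton_altdef)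
  then show "b - 1 \<le> r m" using card_higher[of i s] i by simp
  have mL: "m < L" using L m by (meson le_neq_implies_less)
  show "gap b r m (L - m)"
    unfolding gap_def
  proof (intro conjI allI impI notI)
    fix e assume e: "0 < e \<and> e < L - m" "r (m + e) = b"
    have "\<exists>k>j. k \<le> b \<and> slot k s = m + e"
      using tops_below[of j s "m + e"] j rL e slots_gt[OF m(1)] by auto
    then obtain k where "j < k" "k \<le> b" "slot k s = m + e" by blast
    then have "m + e \<in> slots s" unfolding slots_def by (intro image_eqI[of _ _ k]) auto
    moreover have "m + e \<noteq> L" using e(1) by linarith
    ultimately show False using m(3)[of "m + e"] e(1) by linarith
  qed (use rL mL in auto)
qed

section \<open>The closed walk of a labelling\<close>

definition state :: "nat \<Rightarrow> nat \<Rightarrow> nat" where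
  "state s i = (if Suc (s + i) \<in> slots s then 1 else 0)"

lemma slots_state: "slots s = (\<lambda>i. Suc (s + i)) ` {i. state s i = 1}"
proof -
  have "x \<in> (\<lambda>i. Suc (s + i)) ` {i. state s i = 1}" if "x \<in> slots s" for x
    using slots_gt[OF that] that by (intro image_eqI[of _ _ "x - Suc s"]) (auto simp: state_def)
  then show ?thesis by (auto simp: state_def split: if_splits)
qed

lemma support_state: "{i. state s i \<noteq> 0} = {i. state s i = 1}"
  by (auto simp: state_def)

lemma inj_shift: "inj_on (\<lambda>i. Suc (s + i)) A"
  by (auto simp: inj_on_def)

lemma finite_support: "finite {i. state s i = 1}"
  using finite_imageD[OF finite_slots[of s, unfolded slots_state] inj_shift] .

lemma card_support: "card {i. state s i = 1} = b"
  using card_slots[of s, unfolded slots_state] card_image[OF inj_shift] by metis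

lemma juggling_state: "juggling_state b (state s)"
proof -
  have "(\<Sum>i | state s i = 1. state s i) = (\<Sum>i | state s i = 1. 1)" by (rule sum.cong) auto
  then show ?thesis
    using finite_support[of s] card_support[of s]
    unfolding juggling_state_def support_state by (auto simp: state_def)
qed

lemma transition_state: "transition (state s) (state (Suc s))"
  unfolding transition_def state_def using slots_subset[of s] by (auto split: if_splits)

lemma state_add_period: "state (s + n) = state s"
proof
  fix i
  have *: "slots (s + n) = (\<lambda>x. x + n) ` slots s"
    unfolding slots_def image_image by (rule image_cong) (simp_all add: slot_add_period)
  have "Suc (s + n + i) = Suc (s + i) + n" by simp
  then have "Suc (s + n + i) \<in> slots (s + n) \<longleftrightarrow> Suc (s + i) \<in> slots s"
    unfolding * by (metis (no_types, lifting) add_right_cancel imageE imageI)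
  then show "state (s + n) i = state s i" by (simp add: state_def)
qed

lemma state_mod: "state (s mod n) = state s"
proof -
  have "state (s + q * n) = state s" for s q
  proof (induction q)
    case (Suc q)
    have "s + Suc q * n = (s + q * n) + n" by simp
    then show ?case using Suc state_add_period[of "s + q * n"] by (simp only:)
  qed simp
  from this[of "s mod n" "s div n"] show ?thesis by simp
qed

lemma label_mod: "r (x mod n) = r x"
  using periodic_mult[of "x mod n" "x div n"] by simp

lemma label_eq_0: "r (Suc s) = 0 \<longleftrightarrow> state s 0 = 0"
  using Suc_in_slots[of s] by (simp add: state_def)

text \<open>A throw shows up as a landing time that is free in one state and occupied in the next;
  its label is then given by \<open>label_new_slot\<close>.\<close>

lemma label_from_states:
  assumes "state s (Suc i) = 0" "state (Suc s) i = 1"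
  shows "r (Suc (Suc (s + i))) = b - card {j. i < j \<and> state (Suc s) j = 1}"
proof -
  let ?x = "Suc (Suc (s + i))"
  have x: "?x \<in> slots (Suc s)" "?x \<notin> slots s"
    using assms by (auto simp: state_def split: if_splits)
  have "{y \<in> slots (Suc s). ?x < y} = (\<lambda>j. Suc (Suc s + j)) ` {j. i < j \<and> state (Suc s) j = 1}"
    by (subst slots_state) auto
  then have "card {y \<in> slots (Suc s). ?x < y} = card {j. i < j \<and> state (Suc s) j = 1}"
    using card_image[OF inj_shift] by metis
  then show ?thesis using label_new_slot[of "Suc s"] new_slot[OF x] by simp
qed

lemma throw_ex:
  assumes "0 < r x"
  shows "\<exists>s i. state s (Suc i) = 0 \<and> state (Suc s) i = 1 \<and> Suc (Suc (s + i)) mod n = x mod n"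
proof -
  \<comment> \<open>The throws of balls in the air at time 0 lie in the past; \<open>y\<close> is a
    translate of \<open>x\<close> by periods that lands after all of these.\<close>
  obtain B where B: "\<And>y. y \<in> slots 0 \<Longrightarrow> y \<le> B"
    using finite_slots[of 0] finite_nat_set_iff_bounded_le by auto
  define y where "y = x + Suc B * n"
  have "B < y" unfolding y_def by (rule less_add_period)
  have ry: "0 < r y" using assms periodic_mult[of x "Suc B"] unfolding y_def by metis
  have "y \<notin> slots 0" using B[of y] \<open>B < y\<close> by auto
  moreover have "y \<in> slots (y - 1)" using Suc_in_slots[of "y - 1"] ry \<open>B < y\<close> by simp
  ultimately obtain s where s: "y \<notin> slots s" "y \<in> slots (Suc s)"
    using ex_least_nat_less[of "\<lambda>s. y \<in> slots s" "y - 1"] by auto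
  have sy: "Suc s < y" using slots_gt[OF s(2)] .
  define i where "i = y - Suc (Suc s)"
  have y: "y = Suc (Suc (s + i))" using sy by (simp add: i_def)
  have "y mod n = x mod n" unfolding y_def by (rule mod_mult_self1)
  moreover have "state s (Suc i) = 0" "state (Suc s) i = 1" using s y by (auto simp: state_def)
  ultimately show ?thesis using y by metis
qed

definition cycle :: "(nat \<Rightarrow> nat) list" where
  "cycle = map state [0..<n]"

text \<open>The column condition for right-aligned blocks: the gap \<open>d\<close> tells the column
  of \<open>m\<close>.\<close>

definition good :: bool where
  "good \<longleftrightarrow> (\<forall>m m' d. b - 1 \<le> r m \<longrightarrow> b - 1 \<le> r m' \<longrightarrow> gap b r m d \<longrightarrow> gap b r m' d \<longrightarrow> m mod n = m' mod n)"

text \<open>The state alone determines the offsets \<open>m < M\<close> of its two latest landings,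
  so equal states yield two labels at least \<open>b - 1\<close> with the same gap
  \<open>M - m\<close>. Goodness identifies their times modulo \<open>n\<close>.\<close>

lemma state_eq_imp:
  assumes good "state s = state s'"
  shows "s mod n = s' mod n"
proof -
  define A where "A = {i. state s i = 1}"
  have A': "A = {i. state s' i = 1}" using assms by (simp add: A_def)
  have fin: "finite A" "card A = b" using finite_support card_support by (auto simp: A_def)
  then have "A \<noteq> {}" using b_ge2 by auto
  define M where "M = Max A"
  have M: "M \<in> A" "\<And>i. i \<in> A \<Longrightarrow> i \<le> M" using fin \<open>A \<noteq> {}\<close> by (auto simp: M_def)
  have "card (A - {M}) = b - 1" using fin M by simp
  then have ne: "A - {M} \<noteq> {}" using b_ge2 by (metis card.empty diff_is_0_eq not_less_eq_eq numeral_2_eq_2 One_nat_def)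
  define m where "m = Max (A - {M})"
  have "m \<in> A - {M}" using fin ne Max_in[of "A - {M}"] by (simp add: m_def)
  then have m: "m \<in> A" "m \<noteq> M" by auto
  have m': "i \<le> m" if "i \<in> A" "i \<noteq> M" for i using fin that by (auto simp: m_def)
  have *: "b - 1 \<le> r (Suc (u + m)) \<and> gap b r (Suc (u + m)) (M - m)" if "A = {i. state u i = 1}" for u
  proof -
    have X: "slots u = (\<lambda>i. Suc (u + i)) ` A" using slots_state[of u] that by simp
    have 1: "Suc (u + M) \<in> slots u" "Suc (u + m) \<in> slots u" "Suc (u + m) \<noteq> Suc (u + M)"
      using X M m by auto
    have 2: "x \<le> Suc (u + M)" if "x \<in> slots u" for x using that X M by auto
    have 3: "x \<le> Suc (u + m)" if "x \<in> slots u" "x \<noteq> Suc (u + M)" for x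
    proof -
      obtain i where "i \<in> A" "x = Suc (u + i)" using \<open>x \<in> slots u\<close> X by auto
      then show ?thesis using m'[of i] that(2) by auto
    qed
    show ?thesis using top_two[OF 1(1) 2 1(2,3) 3] by simp
  qed
  have "Suc (s + m) mod n = Suc (s' + m) mod n"
    using *[of s] *[of s'] A' assms(1) A_def unfolding good_def by blast
  \<comment> \<open>The common offset is cancelled over the integers, where subtraction respects
    congruence.\<close>
  then have "(int s + int (Suc m)) mod int n = (int s' + int (Suc m)) mod int n"
    by (metis add_Suc_right of_nat_add of_nat_mod)
  then have "int s mod int n = int s' mod int n" by (metis add_diff_cancel_right' mod_diff_left_eq)
  then show ?thesis by (metis of_nat_eq_iff of_nat_mod)
qed

lemma cycle_in: assumes good shows "cycle \<in> rooted_cycles b n"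
proof -
  have "inj_on state {0..<n}"
    using state_eq_imp[OF assms] by (fastforce simp: inj_on_def)
  moreover have "transition (cycle ! k) (cycle ! (Suc k mod n))" if "k < n" for k
    using that n_pos transition_state[of k] by (simp add: cycle_def state_mod)
  ultimately show ?thesis using juggling_state
    by (auto simp: rooted_cycles_def cycle_def distinct_map)
qed

end

text \<open>The label 0 is seen from entry 0 of the preceding state, and a positive label from the
  pair of states around its throw, so a shift of the states by \<open>k\<close> shifts the labels by
  \<open>k\<close>.\<close>

lemma states_determine_labels:
  assumes "landing_labels b n r" "landing_labels b n r'"
    and eq: "\<And>s. landing_labels.state b r' s = landing_labels.state b r (s + k)"
  shows "r' x = r (x + k)"
proof -
  interpret A: landing_labels b n r by fact
  interpret B: landing_labels b n r' by fact
  \<comment> \<open>One period is added so that \<open>x\<close> has a predecessor even when it is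
    0.\<close>
  define y where "y = x + n - 1"
  have y: "Suc y = x + n" using A.n_pos by (simp add: y_def)
  show ?thesis
  proof (cases "r' x = 0")
    case True
    then have "B.state y 0 = 0" using B.label_eq_0[of y] y B.periodic by simp
    then have "r (Suc (y + k)) = 0" using eq[of y] A.label_eq_0[of "y + k"] by simp
    moreover have "Suc (y + k) = (x + k) + n" using y by simp
    ultimately show ?thesis using A.periodic[of "x + k"] True by simp
  next
    case False
    then obtain s i where si: "B.state s (Suc i) = 0" "B.state (Suc s) i = 1"
        "Suc (Suc (s + i)) mod n = x mod n"
      using B.throw_ex[of x] by auto
    have "r' x = r' (Suc (Suc (s + i)))" using si(3) B.label_mod by metis
    also have "\<dots> = r (Suc (Suc (s + k + i)))"
      using B.label_from_states[OF si(1,2)] A.label_from_states[of "s + k" i] si(1,2)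
        eq[of s] eq[of "Suc s"] by simp
    also have "Suc (Suc (s + k + i)) mod n = (x + k) mod n"
      using mod_add_cong[OF si(3) refl, of k] by (simp add: algebra_simps)
    then have "r (Suc (Suc (s + k + i))) = r (x + k)" using A.label_mod by metis
    finally show ?thesis .
  qed
qed

subsection \<open>Labellings composed of blocks\<close>

lemma juggling_state_card: "juggling_state b \<alpha> \<Longrightarrow> card {i. \<alpha> i \<noteq> 0} = b"
proof -
  assume *: "juggling_state b \<alpha>"
  have "(\<Sum>i | \<alpha> i \<noteq> 0. \<alpha> i) = (\<Sum>i | \<alpha> i \<noteq> 0. 1)"
  proof (intro sum.cong refl)
    fix i assume "i \<in> {i. \<alpha> i \<noteq> 0}"
    moreover have "\<alpha> i \<in> {0, 1}" using * unfolding juggling_state_def by blast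
    ultimately show "\<alpha> i = 1" by auto
  qed
  also have "\<dots> = card {i. \<alpha> i \<noteq> 0}" by simp
  finally show ?thesis using * unfolding juggling_state_def by metis
qed

text \<open>
  A ball at height i is at heights i - n, i - 2 n, \<dots> whenever the same state recurs, so a larger
  height would put more than b balls into one state.
\<close>

lemma rooted_cycle_height:
  assumes ss: "ss \<in> rooted_cycles b n" and \<alpha>: "\<alpha> \<in> set ss" "\<alpha> i \<noteq> 0"
  shows "i < b * n"
proof (rule ccontr)
  assume "\<not> i < b * n"
  then have i: "b * n \<le> i" by simp
  have len: "length ss = n" and st: "\<And>\<alpha>. \<alpha> \<in> set ss \<Longrightarrow> juggling_state b \<alpha>"
    and tr: "\<And>k. k < n \<Longrightarrow> transition (ss ! k) (ss ! (Suc k mod n))"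
    using ss by (auto simp: rooted_cycles_def)
  obtain s where s: "s < n" "\<alpha> = ss ! s" using \<alpha>(1) len by (auto simp: in_set_conv_nth)
  define A where "A k = ss ! (k mod n)" for k
  have step: "A k (Suc h) \<le> A (Suc k) h" for k h
    using tr[of "k mod n"] s(1) by (auto simp: A_def transition_def mod_Suc_eq)
  have fall: "A k (d + h) \<le> A (d + k) h" for k d h
  proof (induction d arbitrary: k)
    case (Suc d)
    have "A k (Suc (d + h)) \<le> A (Suc k) (d + h)" by (rule step)
    also have "\<dots> \<le> A (d + Suc k) h" by (rule Suc)
    finally show ?case by simp
  qed simp
  have fall_period: "\<alpha> (i - q * n) \<noteq> 0" if "q \<le> b" for q
  proof -
    have "q * n \<le> i" using that i by (meson le_trans mult_le_mono1)
    then have "A s i \<le> A (q * n + s) (i - q * n)" using fall[of s "q * n" "i - q * n"] by simp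
    moreover have "A (q * n + s) = \<alpha>" "A s = \<alpha>" using s by (simp_all add: A_def)
    ultimately show ?thesis using \<alpha>(2) by simp
  qed
  \<comment> \<open>The \<open>b + 1\<close> heights are distinct, since no subtraction is truncated
    when \<open>b * n \<le> i\<close>.\<close>
  have "inj_on (\<lambda>q. i - q * n) {0..b}"
  proof (rule inj_onI)
    fix q q' assume "q \<in> {0..b}" "q' \<in> {0..b}" and eq: "i - q * n = i - q' * n"
    then have "q * n \<le> i" "q' * n \<le> i" using i by (auto intro: le_trans[OF mult_le_mono1])
    then have "q * n = q' * n" using eq by linarith
    then show "q = q'" using s(1) by simp
  qed
  then have "card {0..b} \<le> card {i. \<alpha> i \<noteq> 0}"
    using fall_period st[OF \<alpha>(1)] unfolding juggling_state_def
    by (intro card_inj_on_le[of "\<lambda>q. i - q * n"]) auto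
  then show False using juggling_state_card[OF st[OF \<alpha>(1)]] by simp
qed

text \<open>Bounded heights leave finitely many states. Finiteness matters because
  \<open>card\<close> is 0 on infinite sets, so an injection alone would give no lower
  bound.\<close>

lemma finite_rooted_cycles: "finite (rooted_cycles b n)"
proof -
  define Z :: "(nat \<Rightarrow> nat) set" where "Z = (\<lambda>S i. if i \<in> S then 1 else 0) ` Pow {..<b * n}"
  have "finite Z" by (simp add: Z_def)
  have "rooted_cycles b n \<subseteq> {ss. set ss \<subseteq> Z \<and> length ss = n}"
  proof (intro subsetI CollectI conjI)
    fix ss \<alpha> assume ss: "ss \<in> rooted_cycles b n" and \<alpha>: "\<alpha> \<in> set ss"
    have "{i. \<alpha> i \<noteq> 0} \<in> Pow {..<b * n}" using rooted_cycle_height[OF ss \<alpha>] by auto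
    moreover have "\<alpha> = (\<lambda>i. if i \<in> {i. \<alpha> i \<noteq> 0} then 1 else 0)"
    proof
      fix i
      have "\<alpha> i \<in> {0, 1}" using ss \<alpha> unfolding rooted_cycles_def juggling_state_def by blast
      then show "\<alpha> i = (if i \<in> {i. \<alpha> i \<noteq> 0} then 1 else 0)" by auto
    qed
    ultimately show "\<alpha> \<in> Z" unfolding Z_def by blast
  qed (auto simp: rooted_cycles_def)
  then show ?thesis using finite_lists_length_eq[OF \<open>finite Z\<close>] by (rule finite_subset)
qed

text \<open>A family of cycles, no two of them rotations of each other, injects into the set of
  rotation classes.\<close>

lemma card_le_num_prime_patterns:
  assumes "\<And>x. x \<in> S \<Longrightarrow> f x \<in> rooted_cycles b n"
    and "\<And>x y k. x \<in> S \<Longrightarrow> y \<in> S \<Longrightarrow> f y = rotate k (f x) \<Longrightarrow> x = y"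
  shows "card S \<le> num_prime_patterns b n"
proof -
  let ?R = "rotation_rel (rooted_cycles b n)"
  have fin: "finite (prime_patterns b n)"
    using finite_rooted_cycles by (simp add: prime_patterns_def quotient_def)
  have "inj_on (\<lambda>x. ?R `` {f x}) S"
  proof (rule inj_onI)
    fix x y assume xy: "x \<in> S" "y \<in> S" "?R `` {f x} = ?R `` {f y}"
    have "f y = rotate 0 (f y)" by simp
    then have "f y \<in> ?R `` {f y}" using assms(1)[OF xy(2)] unfolding rotation_rel_def by blast
    then have "f y \<in> ?R `` {f x}" using xy by simp
    then obtain k where "f y = rotate k (f x)" by (auto simp: rotation_rel_def)
    then show "x = y" using assms(2) xy by blast
  qed
  moreover have "(\<lambda>x. ?R `` {f x}) ` S \<subseteq> prime_patterns b n"
    using assms(1) by (auto simp: prime_patterns_def intro: quotientI)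
  ultimately show ?thesis unfolding num_prime_patterns_def using fin by (intro card_inj_on_le)
qed

text \<open>Starting with the longest block selects one representative of each rotation class.\<close>

definition block_words :: "nat \<Rightarrow> nat \<Rightarrow> nat list list set" where
  "block_words b n = {bs. bs \<noteq> [] \<and> length (concat bs) = n \<and>
     (\<forall>B\<in>set bs. B \<noteq> [] \<and> hd B = b \<and> (\<forall>x\<in>set (tl B). x < b) \<and> length B \<le> length (hd bs)) \<and>
     (\<forall>i<length bs. \<forall>i'<length bs. \<forall>k. k < length (bs ! i) \<longrightarrow> k < length (bs ! i') \<longrightarrow>
        b - 1 \<le> rev (bs ! i) ! k \<longrightarrow> b - 1 \<le> rev (bs ! i') ! k \<longrightarrow> i = i')}"

section \<open>Block words read as periodic labellings\<close>

definition cyclic_nth :: "nat list list \<Rightarrow> nat \<Rightarrow> nat" where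
  "cyclic_nth bs x = concat bs ! (x mod length (concat bs))"

definition block_start :: "nat list list \<Rightarrow> nat \<Rightarrow> nat" where
  "block_start bs i = length (concat (take i bs))"

lemma concat_split_at:
  "i < length bs \<Longrightarrow> concat bs = concat (take i bs) @ bs ! i @ concat (drop (Suc i) bs)"
  by (metis concat.simps(2) concat_append id_take_nth_drop)

lemma concat_nth_block:
  "i < length bs \<Longrightarrow> q < length (bs ! i) \<Longrightarrow> concat bs ! (block_start bs i + q) = bs ! i ! q"
  by (subst concat_split_at, assumption) (simp add: nth_append block_start_def)

lemma block_start_Suc: "i < length bs \<Longrightarrow> block_start bs (Suc i) = block_start bs i + length (bs ! i)"
  by (simp add: block_start_def take_Suc_conv_app_nth)

lemma block_start_le: "i < length bs \<Longrightarrow> block_start bs i + length (bs ! i) \<le> length (concat bs)"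
  using arg_cong[OF concat_split_at, of i bs length] by (simp add: block_start_def)

lemma block_start_length: "block_start bs (length bs) = length (concat bs)"
  by (simp add: block_start_def)

lemma block_position_ex:
  "x < length (concat bs) \<Longrightarrow> \<exists>i q. i < length bs \<and> q < length (bs ! i) \<and> x = block_start bs i + q"
proof (induction bs arbitrary: x)
  case (Cons B bs)
  show ?case
  proof (cases "x < length B")
    case True
    then show ?thesis by (intro exI[of _ 0] exI[of _ x]) (simp add: block_start_def)
  next
    case False
    then have "x - length B < length (concat bs)" using Cons.prems by simp
    then obtain i q where iq: "i < length bs" "q < length (bs ! i)" "x - length B = block_start bs i + q"
      using Cons.IH by blast
    then show ?thesis using False
      by (intro exI[of _ "Suc i"] exI[of _ q]) (simp add: block_start_def)
  qed
qed simp

text \<open>The label \<open>b\<close> occurs exactly at the beginnings of blocks, so it marks where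
  to cut.\<close>

lemma concat_blocks_inj:
  assumes "\<forall>B\<in>set bs. B \<noteq> [] \<and> hd B = b \<and> b \<notin> set (tl B)"
    and "\<forall>B\<in>set bs'. B \<noteq> [] \<and> hd B = b \<and> b \<notin> set (tl B)"
    and "concat bs = concat bs'"
  shows "bs = bs'"
  using assms
proof (induction bs arbitrary: bs')
  case Nil
  then show ?case by (cases bs') auto
next
  case (Cons B bs)
  then have "concat bs' \<noteq> []" by (metis append_is_Nil_conv concat.simps(2) list.set_intros(1))
  then obtain B' cs where bs': "bs' = B' # cs" by (cases bs') simp_all
  \<comment> \<open>After its leading \<open>b\<close>, the first block extends up to the next
    \<open>b\<close> or the end of the word.\<close>
  have tw: "takeWhile (\<lambda>x. x \<noteq> b) (tl B @ concat cs) = tl B"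
    if "b \<notin> set (tl B)" "\<forall>B\<in>set cs. B \<noteq> [] \<and> hd B = b" for B cs
  proof -
    have "takeWhile (\<lambda>x. x \<noteq> b) (concat cs) = []"
    proof (cases cs)
      case (Cons C cs')
      then show ?thesis using that(2) by (cases C) auto
    qed simp
    moreover have "\<And>x. x \<in> set (tl B) \<Longrightarrow> x \<noteq> b" using that(1) by blast
    ultimately show ?thesis by (simp add: takeWhile_append2)
  qed
  obtain xs xs' where x: "B = b # xs" "B' = b # xs'"
    using Cons.prems(1,2) bs' by (metis list.collapse list.set_intros(1))
  have eq: "xs @ concat bs = xs' @ concat cs" using Cons.prems(3) by (simp add: bs' x)
  have "takeWhile (\<lambda>y. y \<noteq> b) (xs @ concat bs) = xs" "takeWhile (\<lambda>y. y \<noteq> b) (xs' @ concat cs) = xs'"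
    using tw[of B bs] tw[of B' cs] Cons.prems(1,2) by (simp_all add: bs' x)
  then have "xs = xs'" using eq by simp
  then have "B = B'" "concat bs = concat cs" using eq x by simp_all
  moreover from this have "bs = cs"
    using Cons.prems(1,2) by (intro Cons.IH) (simp_all add: bs')
  ultimately show ?case by (simp add: bs')
qed

lemma gap_unique: "gap b r m d \<Longrightarrow> gap b r m d' \<Longrightarrow> d = d'"
  unfolding gap_def by (metis linorder_neqE_nat)

context
  fixes b n :: nat and bs :: "nat list list"
  assumes bs: "bs \<in> block_words b n"
begin

lemma block_words_length: "length (concat bs) = n"
  using bs by (simp add: block_words_def)

lemma block_props:
  assumes "i < length bs"
  shows "0 < length (bs ! i)" "bs ! i ! 0 = b" "length (bs ! i) \<le> length (bs ! 0)"
    "0 < q \<Longrightarrow> q < length (bs ! i) \<Longrightarrow> bs ! i ! q < b"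
proof -
  have B: "bs ! i \<in> set bs" "bs \<noteq> []" using assms by auto
  show "0 < length (bs ! i)" "bs ! i ! 0 = b" "length (bs ! i) \<le> length (bs ! 0)"
    using bs B by (auto simp: block_words_def hd_conv_nth)
  assume q: "0 < q" "q < length (bs ! i)"
  then have "tl (bs ! i) ! (q - 1) \<in> set (tl (bs ! i))" by (intro nth_mem) auto
  then show "bs ! i ! q < b" using bs B q by (auto simp: block_words_def nth_tl)
qed

lemma zero_less_length: "0 < length bs"
  using bs by (simp add: block_words_def)

lemma n_gt_0: "0 < n"
  using block_start_le[OF zero_less_length] block_props(1)[OF zero_less_length] block_words_length
  by linarith

lemma cyclic_nth_mod: "cyclic_nth bs (x mod n + y) = cyclic_nth bs (x + y)"
  by (simp add: cyclic_nth_def block_words_length mod_add_left_eq)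

lemma cyclic_nth_block:
  "i < length bs \<Longrightarrow> q < length (bs ! i) \<Longrightarrow> cyclic_nth bs (block_start bs i + q) = bs ! i ! q"
  using concat_nth_block[of i bs q] block_start_le[of i bs] by (simp add: cyclic_nth_def)

lemma gap_in_block:
  assumes i: "i < length bs" "q < length (bs ! i)" and m: "m mod n = block_start bs i + q"
  shows "gap b (cyclic_nth bs) m (length (bs ! i) - q)"
  unfolding gap_def
proof (intro conjI allI impI)
  show "0 < length (bs ! i) - q" using i by simp
  have "cyclic_nth bs (m + (length (bs ! i) - q)) = cyclic_nth bs (block_start bs (Suc i))"
    using cyclic_nth_mod[of m "length (bs ! i) - q"] m i by (simp add: block_start_Suc)
  also have "\<dots> = b"
  proof (cases "Suc i < length bs")
    case True
    then show ?thesis using cyclic_nth_block[of "Suc i" 0] block_props[of "Suc i"] by simp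
  next
    case False
    \<comment> \<open>After the last block the word wraps around to the \<open>b\<close> that opens
      the first one.\<close>
    then have "Suc i = length bs" using i by simp
    then have "block_start bs (Suc i) = n" by (simp add: block_start_length block_words_length)
    then have "cyclic_nth bs (block_start bs (Suc i)) = cyclic_nth bs (block_start bs 0 + 0)"
      using cyclic_nth_mod[of n 0] by (simp add: block_start_def)
    then show ?thesis
      using cyclic_nth_block[of 0 0] block_props[of 0] zero_less_length by simp
  qed
  finally show "cyclic_nth bs (m + (length (bs ! i) - q)) = b" .
  fix e assume e: "0 < e \<and> e < length (bs ! i) - q"
  have "cyclic_nth bs (m + e) = cyclic_nth bs (block_start bs i + (q + e))"
    using cyclic_nth_mod[of m e] m by (simp add: add.assoc)
  moreover have qe: "0 < q + e" "q + e < length (bs ! i)" using e by auto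
  ultimately show "cyclic_nth bs (m + e) \<noteq> b"
    using cyclic_nth_block[OF i(1) qe(2)] block_props(4)[OF i(1) qe] by simp
qed

lemma position_ex:
  "\<exists>i q. i < length bs \<and> q < length (bs ! i) \<and> m mod n = block_start bs i + q
     \<and> cyclic_nth bs m = bs ! i ! q \<and> gap b (cyclic_nth bs) m (length (bs ! i) - q)"
proof -
  have "m mod n < length (concat bs)" using n_gt_0 block_words_length by simp
  then obtain i q where iq: "i < length bs" "q < length (bs ! i)" "m mod n = block_start bs i + q"
    using block_position_ex by blast
  then have "cyclic_nth bs m = bs ! i ! q"
    using cyclic_nth_block[of i q] cyclic_nth_mod[of m 0] by simp
  then show ?thesis using iq gap_in_block by blast
qed

lemma landing_labels_block_word:
  assumes "2 \<le> b"
  shows "landing_labels b n (cyclic_nth bs)"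
proof
  show "cyclic_nth bs x \<le> b" for x
  proof -
    obtain i q where "i < length bs" "q < length (bs ! i)" "cyclic_nth bs x = bs ! i ! q"
      using position_ex by blast
    then show ?thesis using block_props(2)[of i] block_props(4)[of i q] by (cases "q = 0") auto
  qed
  show "cyclic_nth bs (x + n) = cyclic_nth bs x" for x
    by (simp add: cyclic_nth_def block_words_length)
  show "\<exists>x. cyclic_nth bs x = b"
    using cyclic_nth_block[of 0 0] block_props[of 0] zero_less_length by auto
qed (use n_gt_0 assms in auto)

text \<open>A time with gap \<open>d\<close> sits in column \<open>d - 1\<close>, counted from the
  right end of its block, so the column condition forces both times into the same block and the same
  place in it.\<close>

lemma good_block_word:
  assumes "b - 1 \<le> cyclic_nth bs m" "b - 1 \<le> cyclic_nth bs m'"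
    "gap b (cyclic_nth bs) m d" "gap b (cyclic_nth bs) m' d"
  shows "m mod n = m' mod n"
proof -
  obtain i q where iq: "i < length bs" "q < length (bs ! i)" "m mod n = block_start bs i + q"
      "cyclic_nth bs m = bs ! i ! q" "d = length (bs ! i) - q"
    using position_ex[of m] gap_unique assms(3) by blast
  obtain i' q' where iq': "i' < length bs" "q' < length (bs ! i')" "m' mod n = block_start bs i' + q'"
      "cyclic_nth bs m' = bs ! i' ! q'" "d = length (bs ! i') - q'"
    using position_ex[of m'] gap_unique assms(4) by blast
  have d: "d - 1 < length (bs ! i)" "d - 1 < length (bs ! i')" using iq iq' by linarith+
  have "length (bs ! i) - Suc (d - 1) = q" "length (bs ! i') - Suc (d - 1) = q'"
    using iq(2,5) iq'(2,5) by linarith+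
  then have "rev (bs ! i) ! (d - 1) = bs ! i ! q" "rev (bs ! i') ! (d - 1) = bs ! i' ! q'"
    using d by (simp_all add: rev_nth)
  moreover have "\<forall>i<length bs. \<forall>i'<length bs. \<forall>k. k < length (bs ! i) \<longrightarrow> k < length (bs ! i') \<longrightarrow>
        b - 1 \<le> rev (bs ! i) ! k \<longrightarrow> b - 1 \<le> rev (bs ! i') ! k \<longrightarrow> i = i'"
    using bs unfolding block_words_def by blast
  ultimately have "i = i'" using iq(1,4) iq'(1,4) d assms(1,2) by metis
  moreover from this have "q = q'" using iq(2,5) iq'(2,5) by simp
  ultimately show ?thesis using iq(3) iq'(3) by simp
qed

lemma first_gap: "cyclic_nth bs 0 = b" "gap b (cyclic_nth bs) 0 (length (bs ! 0))"
  using gap_in_block[of 0 0 0] cyclic_nth_block[of 0 0] block_props[of 0] zero_less_length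
  by (simp_all add: block_start_def)

lemma gap_le_first:
  assumes "gap b (cyclic_nth bs) m d"
  shows "d \<le> length (bs ! 0)"
proof -
  obtain i q where "i < length bs" "d = length (bs ! i) - q"
    using position_ex[of m] gap_unique assms by blast
  then show ?thesis using block_props(3)[of i] by simp
qed

end

text \<open>Times 0 and \<open>k\<close> both carry \<open>b\<close> and, both first blocks being
  longest, have the same gap; \<open>good_block_word\<close> then gives
  \<open>k mod n = 0\<close>.\<close>

lemma block_word_rotation_unique:
  assumes bs: "bs \<in> block_words b n" and bs': "bs' \<in> block_words b n"
    and rot: "\<And>x. cyclic_nth bs' x = cyclic_nth bs (x + k)"
  shows "bs = bs'"
proof -
  let ?r = "cyclic_nth bs" and ?r' = "cyclic_nth bs'"
  have n: "0 < n" using bs n_gt_0 by blast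
  \<comment> \<open>\<open>k'\<close> undoes the rotation, which makes the situation symmetric in
    \<open>bs\<close> and \<open>bs'\<close>.\<close>
  define k' where "k' = n - k mod n"
  have kk': "(k + k') mod n = 0"
  proof -
    have "k mod n < n" "k = k div n * n + k mod n" using n by simp_all
    then have "k + k' = n + k div n * n" unfolding k'_def by linarith
    then show ?thesis by (metis mod_mult_self1 mod_self)
  qed
  have rot': "?r x = ?r' (x + k')" for x
  proof -
    have "x + k' + k = (k + k') + x" by simp
    then have "?r' (x + k') = ?r ((k + k') + x)" using rot[of "x + k'"] by metis
    also have "\<dots> = ?r ((k + k') mod n + x)" by (rule cyclic_nth_mod[OF bs, symmetric])
    finally show ?thesis using kk' by simp
  qed
  have gk: "gap b ?r k (length (bs' ! 0))"
    using first_gap(2)[OF bs'] unfolding gap_def rot by (simp add: add.commute[of k])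
  have gk': "gap b ?r' k' (length (bs ! 0))"
    using first_gap(2)[OF bs] unfolding gap_def rot' by (simp add: add.commute[of k'])
  \<comment> \<open>Each first block occurs as a gap in the other word, hence is at most as long as
    the other first block.\<close>
  have "length (bs ! 0) = length (bs' ! 0)"
    using gap_le_first[OF bs gk] gap_le_first[OF bs' gk'] by simp
  moreover have "?r k = b" using rot[of 0] first_gap(1)[OF bs'] by simp
  ultimately have "k mod n = 0 mod n"
    using good_block_word[OF bs, of k 0] gk first_gap[OF bs] by simp
  then have eq: "?r' x = ?r x" for x
    using rot[of x] cyclic_nth_mod[OF bs, of k x] by (simp add: add.commute[of k])
  have "concat bs = concat bs'"
  proof (rule nth_equalityI)
    show "length (concat bs) = length (concat bs')"
      by (simp only: block_words_length[OF bs] block_words_length[OF bs'])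
    fix x assume "x < length (concat bs)"
    then have "x mod n = x" by (simp only: block_words_length[OF bs] mod_less)
    then show "concat bs ! x = concat bs' ! x"
      using eq[of x] unfolding cyclic_nth_def block_words_length[OF bs] block_words_length[OF bs']
      by simp
  qed
  then show ?thesis
    using bs bs' by (intro concat_blocks_inj[of bs b bs']) (auto simp: block_words_def)
qed

lemma card_block_words_le:
  assumes "2 \<le> b" and S: "S \<subseteq> block_words b n"
  shows "card S \<le> num_prime_patterns b n"
proof (rule card_le_num_prime_patterns)
  let ?f = "\<lambda>bs. landing_labels.cycle b n (cyclic_nth bs)"
  fix bs assume "bs \<in> S"
  then have bs: "bs \<in> block_words b n" using S by blast
  interpret A: landing_labels b n "cyclic_nth bs" using landing_labels_block_word[OF bs assms(1)] .
  have "A.good" unfolding A.good_def using good_block_word[OF bs] by blast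
  then show "?f bs \<in> rooted_cycles b n" by (rule A.cycle_in)
  fix bs' k assume "bs' \<in> S" and rot: "?f bs' = rotate k (?f bs)"
  then have bs': "bs' \<in> block_words b n" using S by blast
  interpret B: landing_labels b n "cyclic_nth bs'" using landing_labels_block_word[OF bs' assms(1)] .
  \<comment> \<open>The lists compare a single period; \<open>state_mod\<close> extends the equality
    to all times.\<close>
  have "B.state s = A.state (s + k)" for s
  proof -
    have s: "s mod n < n" using A.n_pos by simp
    then have "B.state (s mod n) = ?f bs' ! (s mod n)" by (simp add: B.cycle_def)
    also have "\<dots> = A.state ((s mod n + k) mod n)"
      using s unfolding rot by (simp add: A.cycle_def nth_rotate add.commute)
    also have "\<dots> = A.state (s + k)"
      using A.state_mod[of "s + k"] by (simp add: mod_add_left_eq)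
    finally show ?thesis by (simp add: B.state_mod)
  qed
  then have "cyclic_nth bs' x = cyclic_nth bs (x + k)" for x
    by (rule states_determine_labels[OF A.landing_labels_axioms B.landing_labels_axioms])
  then show "bs = bs'" by (rule block_word_rotation_unique[OF bs bs'])
qed

subsection \<open>Counting block words\<close>

lemma down_closed_eq_lessThan:
  assumes "finite (S :: nat set)" "\<And>i j. i \<in> S \<Longrightarrow> j < i \<Longrightarrow> j \<in> S"
  shows "S = {..<card S}"
proof -
  define m where "m = (LEAST i. i \<notin> S)"
  have "m \<notin> S" using assms(1) ex_new_if_finite[of S] unfolding m_def by (metis LeastI infinite_UNIV_nat)
  moreover have "i \<in> S" if "i < m" for i using not_less_Least[of i "\<lambda>i. i \<notin> S"] that by (auto simp: m_def)
  ultimately have "S = {..<m}" using assms(2) by (metis lessThan_iff linorder_neqE_nat subsetI subset_antisym)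
  then show ?thesis by simp
qed

definition column_rows :: "nat list \<Rightarrow> nat \<Rightarrow> nat set" where
  "column_rows p k = {i. i < length p \<and> k < p ! i}"

text \<open>Blocks are right-aligned: row i has length p ! i, and column k has k columns to its right.\<close>

definition columns :: "nat \<Rightarrow> nat list \<Rightarrow> nat \<Rightarrow> (nat \<Rightarrow> nat) set" where
  "columns b p k = {g \<in> column_rows p k \<rightarrow>\<^sub>E {..b}.
     (\<forall>i\<in>column_rows p k. g i = b \<longleftrightarrow> p ! i = Suc k) \<and>
     (\<forall>i\<in>column_rows p k. \<forall>i'\<in>column_rows p k. b - 1 \<le> g i \<longrightarrow> b - 1 \<le> g i' \<longrightarrow> i = i')}"

lemma finite_column_rows: "finite (column_rows p k)"
  by (simp add: column_rows_def)

lemma finite_columns: "finite (columns b p k)"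
  unfolding columns_def by (intro finite_subset[OF _ finite_PiE[OF finite_column_rows finite_atMost]]) auto

section \<open>Fillings of a single column\<close>

lemma card_one_special:
  fixes c :: nat
  assumes "finite I" "i0 \<in> I"
  shows "card (PiE I (\<lambda>i. if i = i0 then {v} else {..<c})) = c ^ (card I - 1)"
proof -
  have "(\<Prod>i\<in>I. card (if i = i0 then {v} else {..<c})) = (\<Prod>i\<in>I - {i0}. card (if i = i0 then {v} else {..<c}))"
    using assms by (subst prod.remove[of I i0]) auto
  also have "\<dots> = (\<Prod>i\<in>I - {i0}. c)" by (intro prod.cong) auto
  finally show ?thesis using assms by (simp add: card_PiE)
qed

text \<open>Exactly one row begins in this column. Its entry is \<open>b\<close>, which uses up the
  one large label, and each other row has the \<open>b - 1\<close> values below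
  \<open>b - 1\<close>.\<close>

lemma card_columns_corner:
  assumes b: "2 \<le> b" and p: "distinct p" "Suc k \<in> set p"
  shows "(b - 1) ^ (card (column_rows p k) - 1) \<le> card (columns b p k)"
proof -
  let ?I = "column_rows p k"
  obtain i0 where i0: "i0 < length p" "p ! i0 = Suc k" using p by (auto simp: in_set_conv_nth)
  then have I: "i0 \<in> ?I" by (simp add: column_rows_def)
  have unique: "p ! i = Suc k \<longleftrightarrow> i = i0" if "i \<in> ?I" for i
    using that i0 p(1) nth_eq_iff_index_eq[of p i i0] by (auto simp: column_rows_def)
  have "PiE ?I (\<lambda>i. if i = i0 then {b} else {..<b - 1}) \<subseteq> columns b p k"
  proof
    fix g assume g: "g \<in> PiE ?I (\<lambda>i. if i = i0 then {b} else {..<b - 1})"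
    then have *: "g i \<in> (if i = i0 then {b} else {..<b - 1})" if "i \<in> ?I" for i
      using that by (rule PiE_mem)
    have lt: "g i < b - 1" if "i \<in> ?I" "i \<noteq> i0" for i using *[OF that(1)] that(2) by simp
    have eq: "g i0 = b" using *[OF I] by simp
    have val: "g i \<le> b" "g i = b \<longleftrightarrow> p ! i = Suc k" if "i \<in> ?I" for i
      using lt[OF that] eq unique[OF that] by (cases "i = i0"; simp)+
    have "i = i0" if "i \<in> ?I" "b - 1 \<le> g i" for i using lt[OF that(1)] that(2) by linarith
    then have "\<forall>i\<in>?I. \<forall>i'\<in>?I. b - 1 \<le> g i \<longrightarrow> b - 1 \<le> g i' \<longrightarrow> i = i'" by metis
    moreover have "g \<in> ?I \<rightarrow>\<^sub>E {..b}" using val(1) PiE_arb[OF g] by (intro PiE_I) auto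
    ultimately show "g \<in> columns b p k" using val(2) unfolding columns_def by blast
  qed
  from card_mono[OF finite_columns this] show ?thesis
    using card_one_special[OF finite_column_rows I] by simp
qed

text \<open>With \<open>b\<close> excluded, either all entries are below \<open>b - 1\<close> (the
  set \<open>Z\<close>), or row \<open>i0\<close> alone has \<open>b - 1\<close> (the set
  \<open>A i0\<close>). For \<open>j\<close> rows this gives
  \<open>(b - 1) ^ j + j * (b - 1) ^ (j - 1)\<close> fillings.\<close>

lemma card_columns_plain:
  assumes b: "2 \<le> b" and p: "Suc k \<notin> set p" and ne: "column_rows p k \<noteq> {}"
  shows "(b - 1) ^ (card (column_rows p k) - 1) * (card (column_rows p k) + (b - 1)) \<le> card (columns b p k)"
proof -
  let ?I = "column_rows p k"
  have fin: "finite ?I" by (rule finite_column_rows)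
  define Z where "Z = PiE ?I (\<lambda>_. {..<b - 1})"
  define A where "A i0 = PiE ?I (\<lambda>i. if i = i0 then {b - 1} else {..<b - 1})" for i0
  have finA: "finite (A i0)" for i0 unfolding A_def by (intro finite_PiE fin) auto
  have finZ: "finite Z" unfolding Z_def by (intro finite_PiE fin) auto
  have A: "g i = b - 1 \<longleftrightarrow> i = i0" "g i \<le> b - 1" if "g \<in> A i0" "i \<in> ?I" for g i i0
    using PiE_mem[OF that[unfolded A_def]] by (auto split: if_splits)
  have Z: "g i < b - 1" if "g \<in> Z" "i \<in> ?I" for g i
    using PiE_mem[OF that[unfolded Z_def]] by simp
  have noc: "p ! i \<noteq> Suc k" if "i \<in> ?I" for i
    using that p nth_mem[of i p] unfolding column_rows_def by (metis mem_Collect_eq)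
  have disj: "A i \<inter> A j = {}" if "i \<in> ?I" "j \<in> ?I" "i \<noteq> j" for i j
    using A(1)[of _ i i] A(1)[of _ j i] that by blast
  have disjZ: "Z \<inter> (\<Union>i\<in>?I. A i) = {}"
  proof -
    have "g \<notin> A i" if "g \<in> Z" "i \<in> ?I" for g i using A(1)[of g i i] Z[OF that] that(2) by auto
    then show ?thesis by blast
  qed
  have sub: "g \<in> columns b p k"
    if ext: "g \<in> extensional ?I" and le: "\<And>i. i \<in> ?I \<Longrightarrow> g i \<le> b - 1"
      and uniq: "\<And>i i'. i \<in> ?I \<Longrightarrow> i' \<in> ?I \<Longrightarrow> g i = b - 1 \<Longrightarrow> g i' = b - 1 \<Longrightarrow> i = i'" for g
  proof -
    have "g i \<le> b" "g i \<noteq> b" if "i \<in> ?I" for i using le[OF that] b by linarith+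
    moreover have "i = i'" if "i \<in> ?I" "i' \<in> ?I" "b - 1 \<le> g i" "b - 1 \<le> g i'" for i i'
      using uniq[OF that(1,2)] le[OF that(1)] le[OF that(2)] that(3,4) by simp
    ultimately show ?thesis using ext noc unfolding columns_def PiE_def by auto
  qed
  have "Z \<union> (\<Union>i\<in>?I. A i) \<subseteq> columns b p k"
  proof
    fix g assume g: "g \<in> Z \<union> (\<Union>i\<in>?I. A i)"
    then have "g \<in> extensional ?I" unfolding Z_def A_def PiE_def by blast
    moreover have "g i \<le> b - 1" if "i \<in> ?I" for i using g A(2) Z that by (blast intro: less_imp_le)
    moreover have "i = i'" if "i \<in> ?I" "i' \<in> ?I" "g i = b - 1" "g i' = b - 1" for i i'
    proof (cases "g \<in> Z")
      case True
      then show ?thesis using Z[OF True that(1)] that(3) by simp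
    next
      case False
      then obtain i0 where "g \<in> A i0" using g by blast
      then show ?thesis using A(1)[of g i0 i] A(1)[of g i0 i'] that by simp
    qed
    ultimately show "g \<in> columns b p k" by (rule sub)
  qed
  then have "card (Z \<union> (\<Union>i\<in>?I. A i)) \<le> card (columns b p k)" by (rule card_mono[OF finite_columns])
  moreover have "card (Z \<union> (\<Union>i\<in>?I. A i)) = card Z + card (\<Union>i\<in>?I. A i)"
    using fin finA finZ disjZ by (intro card_Un_disjoint) auto
  moreover have "card (\<Union>i\<in>?I. A i) = (\<Sum>i\<in>?I. card (A i))"
    using fin finA disj by (intro card_UN_disjoint) auto
  moreover have "(\<Sum>i\<in>?I. card (A i)) = card ?I * (b - 1) ^ (card ?I - 1)"
    using card_one_special[OF fin] by (simp add: A_def)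
  moreover have "card Z = (b - 1) * (b - 1) ^ (card ?I - 1)"
  proof -
    have "card Z = (b - 1) ^ card ?I" using fin by (simp add: Z_def card_PiE)
    moreover obtain m where "card ?I = Suc m" using ne fin by (cases "card ?I") auto
    ultimately show ?thesis by simp
  qed
  ultimately show ?thesis by (simp add: algebra_simps)
qed

section \<open>The product over the columns of a strict partition\<close>

context
  fixes n t :: nat and p :: "nat list"
  assumes p: "p \<in> strict_partitions n t" and t: "1 \<le> t"
begin

lemma length_p: "length p = t" and sum_p: "(\<Sum>i<t. p ! i) = n" and p_pos: "i < t \<Longrightarrow> 1 \<le> p ! i"
  and p_less: "i < j \<Longrightarrow> j < t \<Longrightarrow> p ! j < p ! i"
  using p by (auto simp: strict_partitions_def sum_list_sum_nth atLeast0LessThan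
      intro: sorted_wrt_nth_less[of "(>)" p i j])

lemma p_le_first: "i < t \<Longrightarrow> p ! i \<le> p ! 0"
  using p_less[of 0 i] by (cases "i = 0") auto

lemma p_inj: "i < t \<Longrightarrow> j < t \<Longrightarrow> p ! i = p ! j \<Longrightarrow> i = j"
  using p_less[of i j] p_less[of j i] by (metis less_irrefl linorder_neqE_nat)

lemma distinct_p: "distinct p"
  using p_inj length_p by (auto simp: distinct_conv_nth)

lemma column_rows_lessThan: "column_rows p k = {..<card (column_rows p k)}"
proof (rule down_closed_eq_lessThan[OF finite_column_rows])
  fix i j assume "i \<in> column_rows p k" "j < i"
  then show "j \<in> column_rows p k" using p_less[of j i] by (auto simp: column_rows_def length_p)
qed

lemma column_rows_corner: "i < t \<Longrightarrow> card (column_rows p (p ! i - 1)) = Suc i"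
proof -
  assume i: "i < t"
  have "column_rows p (p ! i - 1) = {..i}"
  proof (intro equalityI subsetI)
    fix j assume "j \<in> column_rows p (p ! i - 1)"
    then have "j < t" "p ! i - 1 < p ! j" by (auto simp: column_rows_def length_p)
    then have "\<not> i < j" using p_less[of i j] by linarith
    then show "j \<in> {..i}" by simp
  next
    fix j assume "j \<in> {..i}"
    then show "j \<in> column_rows p (p ! i - 1)" using p_less[of j i] p_pos[OF i] i
      by (cases "j = i") (auto simp: column_rows_def length_p)
  qed
  then show ?thesis by simp
qed

text \<open>The ratios telescope to \<open>(real (Suc j) + c) / c\<close>, whose denominator cancels
  one power of \<open>c\<close>.\<close>

lemma prod_consecutive_ratio:
  fixes c :: real
  assumes "0 < c"
  shows "(\<Prod>i<Suc j. c * ((real (Suc i) + c) / (real i + c))) = c ^ j * (real (Suc j) + c)"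
proof (induction j)
  case 0
  then show ?case using assms by simp
next
  case (Suc j)
  have "real (Suc j) + c \<noteq> 0" using assms by linarith
  then show ?case unfolding prod.lessThan_Suc[of _ "Suc j"] Suc by (simp add: field_simps)
qed

text \<open>First every column gets the weight of a column without a block start; the product is
  regrouped by rows. Then the surplus factors of the \<open>t\<close> columns with a block start are
  divided out.\<close>

lemma prod_columns:
  fixes c :: real
  assumes c: "0 < c"
  shows "(\<Prod>k<p ! 0. c ^ (card (column_rows p k) - 1) *
            (if Suc k \<in> set p then 1 else real (card (column_rows p k)) + c)) =
    c ^ n * (\<Prod>i<t. ((real (Suc i) + c) / (real i + c)) ^ (p ! i)) / (\<Prod>i<t. real (Suc i) + c)"
proof -
  define J where "J k = card (column_rows p k)" for k
  define x where "x i = c * ((real (Suc i) + c) / (real i + c))" for i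
  \<comment> \<open>The weight of a column is spread over the rows reaching it, with factor
    \<open>x i\<close> for row \<open>i\<close>.\<close>
  have "(\<Prod>k<p ! 0. c ^ (J k - 1) * (real (J k) + c)) = (\<Prod>k<p ! 0. \<Prod>i | i \<in> {..<t} \<and> k < p ! i. x i)"
  proof (rule prod.cong[OF refl])
    fix k assume "k \<in> {..<p ! 0}"
    then have "0 \<in> column_rows p k" using t by (simp add: column_rows_def length_p)
    then have "J k \<noteq> 0" using finite_column_rows[of p k] by (auto simp: J_def)
    then obtain j where j: "J k = Suc j" by (cases "J k") auto
    have "{i. i \<in> {..<t} \<and> k < p ! i} = {..<Suc j}"
      using column_rows_lessThan[of k] j by (auto simp: J_def column_rows_def length_p)
    then show "c ^ (J k - 1) * (real (J k) + c) = (\<Prod>i | i \<in> {..<t} \<and> k < p ! i. x i)"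
      using prod_consecutive_ratio[OF c, of j] by (simp add: j x_def)
  qed
  \<comment> \<open>Exchanging the products collects \<open>x i\<close> once for each of the
    \<open>p ! i\<close> cells of row \<open>i\<close>.\<close>
  also have "\<dots> = (\<Prod>i<t. \<Prod>k | k \<in> {..<p ! 0} \<and> k < p ! i. x i)"
    by (rule prod.swap_restrict) auto
  also have "\<dots> = (\<Prod>i<t. x i ^ (p ! i))"
  proof (rule prod.cong[OF refl])
    fix i assume "i \<in> {..<t}"
    then have "{k. k \<in> {..<p ! 0} \<and> k < p ! i} = {..<p ! i}" using p_le_first[of i] by auto
    then show "(\<Prod>k | k \<in> {..<p ! 0} \<and> k < p ! i. x i) = x i ^ (p ! i)" by simp
  qed
  also have "\<dots> = c ^ n * (\<Prod>i<t. ((real (Suc i) + c) / (real i + c)) ^ (p ! i))"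
    unfolding x_def power_mult_distrib prod.distrib power_sum[symmetric] sum_p ..
  finally have 1: "(\<Prod>k<p ! 0. c ^ (J k - 1) * (real (J k) + c)) =
    c ^ n * (\<Prod>i<t. ((real (Suc i) + c) / (real i + c)) ^ (p ! i))" .
  have "(\<Prod>k<p ! 0. if Suc k \<in> set p then real (J k) + c else 1) =
     (\<Prod>k\<in>{k \<in> {..<p ! 0}. Suc k \<in> set p}. real (J k) + c)"
    by (rule prod.inter_filter[symmetric]) simp
  \<comment> \<open>Row \<open>i\<close> begins in column \<open>p ! i - 1\<close>, which exactly
    the rows 0 to \<open>i\<close> reach.\<close>
  also have "\<dots> = (\<Prod>i<t. real (Suc i) + c)"
  proof (rule prod.reindex_bij_betw[symmetric, where h = "\<lambda>i. p ! i - 1", THEN trans])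
    show "bij_betw (\<lambda>i. p ! i - 1) {..<t} {k \<in> {..<p ! 0}. Suc k \<in> set p}"
    proof (rule bij_betw_imageI)
      show "inj_on (\<lambda>i. p ! i - 1) {..<t}"
      proof (rule inj_onI)
        fix i j assume "i \<in> {..<t}" "j \<in> {..<t}" "p ! i - 1 = p ! j - 1"
        moreover from this have "1 \<le> p ! i" "1 \<le> p ! j" using p_pos by blast+
        ultimately have "p ! i = p ! j" by linarith
        then show "i = j" using p_inj \<open>i \<in> {..<t}\<close> \<open>j \<in> {..<t}\<close> by blast
      qed
      show "(\<lambda>i. p ! i - 1) ` {..<t} = {k \<in> {..<p ! 0}. Suc k \<in> set p}"
      proof (intro equalityI subsetI)
        fix k assume "k \<in> (\<lambda>i. p ! i - 1) ` {..<t}"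
        then obtain i where i: "i < t" "k = p ! i - 1" by auto
        then have "Suc k = p ! i" using p_pos[of i] by simp
        moreover have "p ! i \<in> set p" using i length_p by simp
        ultimately show "k \<in> {k \<in> {..<p ! 0}. Suc k \<in> set p}"
          using p_le_first[OF i(1)] by simp
      next
        fix k assume "k \<in> {k \<in> {..<p ! 0}. Suc k \<in> set p}"
        then obtain i where "i < t" "p ! i = Suc k" by (auto simp: in_set_conv_nth length_p)
        then show "k \<in> (\<lambda>i. p ! i - 1) ` {..<t}" by (intro image_eqI[of _ _ i]) simp_all
      qed
    qed
    show "(\<Prod>i<t. real (J (p ! i - 1)) + c) = (\<Prod>i<t. real (Suc i) + c)"
    proof (rule prod.cong[OF refl])
      fix i assume "i \<in> {..<t}"
      then show "real (J (p ! i - 1)) + c = real (Suc i) + c"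
        unfolding J_def by (subst column_rows_corner) simp_all
    qed
  qed
  finally have 2: "(\<Prod>k<p ! 0. if Suc k \<in> set p then real (J k) + c else 1) = (\<Prod>i<t. real (Suc i) + c)" .
  have "(\<Prod>k<p ! 0. c ^ (J k - 1) * (if Suc k \<in> set p then 1 else real (J k) + c)) *
      (\<Prod>k<p ! 0. if Suc k \<in> set p then real (J k) + c else 1) =
      (\<Prod>k<p ! 0. c ^ (J k - 1) * (real (J k) + c))"
    unfolding prod.distrib[symmetric] by (rule prod.cong) simp_all
  then have 3: "(\<Prod>k<p ! 0. c ^ (J k - 1) * (if Suc k \<in> set p then 1 else real (J k) + c)) *
      (\<Prod>i<t. real (Suc i) + c) = c ^ n * (\<Prod>i<t. ((real (Suc i) + c) / (real i + c)) ^ (p ! i))"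
    unfolding 1 2 .
  have "0 < (\<Prod>i<t. real (Suc i) + c)" using c by (intro prod_pos) simp
  then have "(\<Prod>i<t. real (Suc i) + c) \<noteq> 0" by (rule less_imp_neq[symmetric])
  then show ?thesis using 3 unfolding J_def by (rule eq_divide_imp)
qed

text \<open>The divisor of \<open>prod_columns\<close> is (t+b-1)!/(b-1)!, and 1/b divided by the
  binomial coefficient is (t-1)! (b-1)!/(t+b-1)!. So exactly the number (t-1)! of block arrangements
  remains as a factor.\<close>

lemma card_fillings:
  assumes b: "2 \<le> b"
  shows "1 / real b * ((real b - 1) ^ n / real ((t + b - 1) choose b) *
       (\<Prod>i = 1..t. ((real i + real b - 1) / (real i + real b - 2)) ^ (p ! (i - 1))))
     \<le> fact (t - 1) * real (card (PiE {..<p ! 0} (columns b p)))"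
proof -
  define c where "c = real b - 1"
  have c: "0 < c" "c = real (b - 1)" using b by (auto simp: c_def)
  define Q where "Q = (\<Prod>i<t. ((real (Suc i) + c) / (real i + c)) ^ (p ! i))"
  have "(\<Prod>k<p ! 0. c ^ (card (column_rows p k) - 1) *
            (if Suc k \<in> set p then 1 else real (card (column_rows p k)) + c))
     \<le> (\<Prod>k<p ! 0. real (card (columns b p k)))"
  proof (rule prod_mono)
    fix k assume "k \<in> {..<p ! 0}"
    then have ne: "column_rows p k \<noteq> {}" using t by (auto simp: column_rows_def length_p intro!: exI[of _ 0])
    let ?l = "c ^ (card (column_rows p k) - 1) *
            (if Suc k \<in> set p then 1 else real (card (column_rows p k)) + c)"
    have "?l \<le> real (card (columns b p k))"
    proof (cases "Suc k \<in> set p")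
      case True
      then show ?thesis using card_columns_corner[OF b distinct_p True]
        unfolding c(2) by (simp flip: of_nat_power)
    next
      case False
      have "?l = real ((b - 1) ^ (card (column_rows p k) - 1) * (card (column_rows p k) + (b - 1)))"
        using False unfolding c(2) by simp
      also have "\<dots> \<le> real (card (columns b p k))"
        using card_columns_plain[OF b False ne] by (simp only: of_nat_le_iff)
      finally show ?thesis .
    qed
    moreover have "0 \<le> ?l" using c by simp
    ultimately show "0 \<le> ?l \<and> ?l \<le> real (card (columns b p k))" by simp
  qed
  then have 1: "c ^ n * Q / (\<Prod>i<t. real (Suc i) + c) \<le> real (card (PiE {..<p ! 0} (columns b p)))"
    unfolding prod_columns[OF c(1)] Q_def by (simp add: card_PiE)
  obtain a where a: "b = Suc a" using b by (cases b) auto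
  have 2: "(\<Prod>i<t. real (Suc i) + c) = fact (t + b - 1) / fact (b - 1)"
  proof (induction t)
    case (Suc s)
    have "fact (Suc (s + a)) = (real (Suc s) + c) * fact (s + a)" by (simp add: c_def a)
    then show ?case unfolding prod.lessThan_Suc Suc by (simp add: a)
  qed (simp add: a)
  have 3: "(\<Prod>i = 1..t. ((real i + real b - 1) / (real i + real b - 2)) ^ (p ! (i - 1))) = Q"
    unfolding Q_def by (simp add: prod.atLeast1_atMost_eq c_def algebra_simps)
  have 4: "real ((t + b - 1) choose b) = fact (t + b - 1) / (fact b * fact (t - 1))"
    using t binomial_fact[of b "t + b - 1", where ?'a = real] by simp
  have 5: "fact b = real b * fact (b - 1)" by (simp add: a)
  have "1 / real b * (c ^ n / real ((t + b - 1) choose b) * Q) =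
     fact (t - 1) * (c ^ n * Q / (\<Prod>i<t. real (Suc i) + c))"
    unfolding 2 4 5 using b by (simp add: field_simps)
  also have "\<dots> \<le> fact (t - 1) * real (card (PiE {..<p ! 0} (columns b p)))"
    by (rule mult_left_mono[OF 1]) simp
  finally show ?thesis unfolding 3 by (simp add: c_def)
qed

end

text \<open>
  The permutation orders the blocks around the cycle; it fixes 0, so that the longest block is first.
\<close>

definition filled_blocks :: "nat list \<times> (nat \<Rightarrow> nat) \<times> (nat \<Rightarrow> nat \<Rightarrow> nat) \<Rightarrow> nat list list" where
  "filled_blocks = (\<lambda>(p, \<tau>, F). map (\<lambda>i. rev (map (\<lambda>k. F k (\<tau> i)) [0..<p ! \<tau> i])) [0..<length p])"

lemma filled_blocks_in:
  assumes b: "2 \<le> b" and p: "p \<in> strict_partitions n t" and t: "1 \<le> t"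
    and \<tau>: "\<tau> permutes {1..<t}" and F: "F \<in> PiE {..<p ! 0} (columns b p)"
  shows "filled_blocks (p, \<tau>, F) \<in> block_words b n"
proof -
  note len = length_p[OF p t]
  have \<tau>': "\<tau> permutes {..<t}" by (rule permutes_subset[OF \<tau>]) auto
  then have \<tau>_less: "\<tau> i < t" if "i < t" for i using permutes_in_image[OF \<tau>', of i] that by simp
  \<comment> \<open>Row 0 is the longest, so the first block has maximal length.\<close>
  have \<tau>0: "\<tau> 0 = 0" using \<tau> by (simp add: permutes_not_in)
  define f where "f i = rev (map (\<lambda>k. F k (\<tau> i)) [0..<p ! \<tau> i])" for i
  have filled_blocks: "filled_blocks (p, \<tau>, F) = map f [0..<t]" by (simp add: filled_blocks_def f_def[abs_def] len)
  have col: "F k i \<le> b" "F k i = b \<longleftrightarrow> p ! i = Suc k" if "i < t" "k < p ! i" for i k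
  proof -
    have "k < p ! 0" using that(2) p_le_first[OF p t that(1)] by linarith
    then have "F k \<in> columns b p k" using PiE_mem[OF F] by simp
    moreover have "i \<in> column_rows p k" using that by (simp add: column_rows_def len)
    ultimately show "F k i \<le> b" "F k i = b \<longleftrightarrow> p ! i = Suc k"
      unfolding columns_def by (auto dest: PiE_mem)
  qed
  have col_unique: "i = i'"
    if "i < t" "k < p ! i" "i' < t" "k < p ! i'" "b - 1 \<le> F k i" "b - 1 \<le> F k i'" for i i' k
  proof -
    have "k < p ! 0" using that(2) p_le_first[OF p t that(1)] by linarith
    then have "F k \<in> columns b p k" using PiE_mem[OF F] by simp
    moreover have "i \<in> column_rows p k" "i' \<in> column_rows p k"
      using that by (simp_all add: column_rows_def len)
    ultimately show ?thesis using that(5,6) unfolding columns_def by blast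
  qed
  have block: "f i \<noteq> []" "hd (f i) = b" "\<forall>x\<in>set (tl (f i)). x < b" "length (f i) \<le> p ! 0"
    if i: "i < t" for i
  proof -
    have ti: "\<tau> i < t" by (rule \<tau>_less[OF i])
    then obtain m where m: "p ! \<tau> i = Suc m" using p_pos[OF p t, of "\<tau> i"]
      by (cases "p ! \<tau> i") auto
    \<comment> \<open>Reversal puts the leftmost column \<open>m\<close> first, where
      \<open>columns\<close> demands the value \<open>b\<close>; the entries to its right differ
      from \<open>b\<close>.\<close>
    then have fi: "f i = F m (\<tau> i) # rev (map (\<lambda>k. F k (\<tau> i)) [0..<m])" by (simp add: f_def)
    show "f i \<noteq> []" "hd (f i) = b" using col(2)[OF ti, of m] m by (simp_all add: fi)
    have "F k (\<tau> i) < b" if "k < m" for k using col[OF ti, of k] m that by simp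
    then show "\<forall>x\<in>set (tl (f i)). x < b" by (auto simp: fi)
    show "length (f i) \<le> p ! 0" using p_le_first[OF p t ti] by (simp add: f_def)
  qed
  have hd0: "hd (map f [0..<t]) = f 0" using t by (simp add: hd_map)
  have "length (f 0) = p ! 0" by (simp add: f_def \<tau>0)
  moreover have "length (concat (map f [0..<t])) = n"
  proof -
    have "length (concat (map f [0..<t])) = (\<Sum>i<t. p ! \<tau> i)"
      by (simp add: length_concat f_def comp_def sum_list_sum_nth atLeast0LessThan)
    also have "\<dots> = (\<Sum>i<t. p ! i)"
      using sum.permute[OF \<tau>', of "\<lambda>i. p ! i"] by (simp add: comp_def)
    finally show ?thesis using sum_p[OF p t] by simp
  qed
  moreover have "i = i'" if "i < t" "i' < t" "k < length (f i)" "k < length (f i')"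
      "b - 1 \<le> rev (f i) ! k" "b - 1 \<le> rev (f i') ! k" for i i' k
  proof -
    have "\<tau> i = \<tau> i'"
      using that \<tau>_less[of i] \<tau>_less[of i'] by (intro col_unique[of _ k]) (auto simp: f_def)
    then show ?thesis using permutes_inj[OF \<tau>'] by (simp add: inj_eq)
  qed
  ultimately show ?thesis
    unfolding filled_blocks block_words_def using t block by (simp add: hd0)
qed

section \<open>Recovering partition, arrangement and filling from the blocks\<close>

lemma strict_partition_eqI:
  assumes "p \<in> strict_partitions n t" "q \<in> strict_partitions m u" "set p = set q"
  shows "p = q"
proof -
  have "sorted_wrt (<) (rev p)" "sorted_wrt (<) (rev q)"
    using assms(1,2) by (auto simp: strict_partitions_def sorted_wrt_rev)
  then have "rev p = rev q" using assms(3) by (intro strict_sorted_equal) auto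
  then show ?thesis by simp
qed

text \<open>The block lengths form the set of parts and so determine \<open>p\<close>. As the parts
  are distinct, the length of block \<open>i\<close> determines \<open>\<tau> i\<close>; then the
  entries determine \<open>F\<close>, which is fixed by convention outside its cells.\<close>

lemma filled_blocks_inj:
  assumes p: "p \<in> strict_partitions n t" "1 \<le> t" and p': "p' \<in> strict_partitions n t'" "1 \<le> t'"
    and \<tau>: "\<tau> permutes {1..<t}" and \<tau>': "\<tau>' permutes {1..<t'}"
    and F: "F \<in> PiE {..<p ! 0} (columns b p)" and F': "F' \<in> PiE {..<p' ! 0} (columns b p')"
    and eq: "filled_blocks (p, \<tau>, F) = filled_blocks (p', \<tau>', F')"
  shows "p = p' \<and> \<tau> = \<tau>' \<and> F = F'"
proof -
  note len = length_p[OF p] and len' = length_p[OF p']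
  have tt: "t' = t" using arg_cong[OF eq, of length] by (simp add: filled_blocks_def len len')
  have t: "\<tau> permutes {..<t}" "\<tau>' permutes {..<t}"
    by (rule permutes_subset[OF \<tau>], auto) (rule permutes_subset[OF \<tau>'], auto simp: tt)
  have rows: "map (\<lambda>k. F k (\<tau> i)) [0..<p ! \<tau> i] = map (\<lambda>k. F' k (\<tau>' i)) [0..<p' ! \<tau>' i]" if "i < t" for i
    using arg_cong[OF eq, of "\<lambda>bs. bs ! i"] that by (simp add: filled_blocks_def len len' tt)
  have lens: "p ! \<tau> i = p' ! \<tau>' i" if "i < t" for i
    using arg_cong[OF rows[OF that], of length] by simp
  have "set p = (\<lambda>i. p ! i) ` \<tau> ` {..<t}"
    using permutes_image[OF t(1)] by (auto simp: set_conv_nth len)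
  also have "\<dots> = (\<lambda>i. p' ! i) ` \<tau>' ` {..<t}"
    unfolding image_image by (rule image_cong) (auto simp: lens)
  also have "\<dots> = set p'"
    using permutes_image[OF t(2)] by (auto simp: set_conv_nth len' tt)
  finally have pp: "p = p'" by (rule strict_partition_eqI[OF p(1) p'(1)])
  have "\<tau> i = \<tau>' i" for i
  proof (cases "i < t")
    case True
    then show ?thesis using lens[OF True] permutes_in_image[OF t(1), of i]
        permutes_in_image[OF t(2), of i] by (auto simp: pp[symmetric] intro: p_inj[OF p])
  next
    case False
    then show ?thesis using t by (simp add: permutes_not_in)
  qed
  then have \<tau>\<tau>: "\<tau> = \<tau>'" by blast
  have ent: "F k i = F' k i" if "i < t" "k < p ! i" for i k
  proof -
    obtain j where j: "j < t" "\<tau> j = i"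
      using permutes_image[OF t(1)] \<open>i < t\<close> by (metis imageE lessThan_iff)
    have "map (\<lambda>k. F k i) [0..<p ! i] = map (\<lambda>k. F' k i) [0..<p ! i]"
      using rows[OF j(1)] unfolding \<tau>\<tau>[symmetric] pp[symmetric] j(2) .
    then show ?thesis using that(2) by (simp only: map_eq_conv set_upt atLeastLessThan_iff) simp
  qed
  have "F = F'"
  proof (rule PiE_ext[OF F F'[folded pp]])
    fix k assume k: "k \<in> {..<p ! 0}"
    have "F k \<in> column_rows p k \<rightarrow>\<^sub>E {..b}" "F' k \<in> column_rows p k \<rightarrow>\<^sub>E {..b}"
      using PiE_mem[OF F k] PiE_mem[OF F'[folded pp] k] by (auto simp: columns_def)
    then show "F k = F' k" by (rule PiE_ext) (auto simp: column_rows_def len ent)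
  qed
  then show ?thesis using pp \<tau>\<tau> by blast
qed

lemma finite_strict_partitions: "finite (strict_partitions n t)"
proof (rule finite_subset)
  show "strict_partitions n t \<subseteq> {p. set p \<subseteq> {..n} \<and> length p = t}"
    by (auto simp: strict_partitions_def member_le_sum_list)
qed (rule finite_lists_length_eq, simp)

(* The outer sum over all t \<ge> 1 stops at n, as strict_partitions n t is empty for t > n;
   p ! (i - 1) is p_i. *)
theorem theorem6p6:
  fixes b n :: nat
  assumes "b \<ge> 2" and "n \<ge> 1"
  shows "real (num_prime_patterns b n) \<ge>
    1 / real b *
    (\<Sum>t = 1..n. \<Sum>p\<in>strict_partitions n t.
       (real b - 1) ^ n / real ((t + b - 1) choose b) *
       (\<Prod>i = 1..t. ((real i + real b - 1) / (real i + real b - 2)) ^ (p ! (i - 1))))"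
proof -
  let ?X = "\<lambda>p. {\<tau>. \<tau> permutes {1..<length p}} \<times> PiE {..<p ! 0} (columns b p)"
  \<comment> \<open>All data from which block words are built; the permutations move only 1 to t-1,
    which yields the factor \<open>fact (t - 1)\<close> in \<open>card_X\<close>.\<close>
  define D where "D = (SIGMA p:(\<Union>t\<in>{1..n}. strict_partitions n t). ?X p)"
  have DE: "\<exists>t. 1 \<le> t \<and> p \<in> strict_partitions n t \<and> \<tau> permutes {1..<t} \<and> F \<in> PiE {..<p ! 0} (columns b p)"
    if "(p, \<tau>, F) \<in> D" for p \<tau> F
    using that by (auto simp: D_def strict_partitions_def)
  have "inj_on filled_blocks D"
  proof (rule inj_onI)
    fix x y assume xy: "x \<in> D" "y \<in> D" "filled_blocks x = filled_blocks y"
    obtain p \<tau> F p' \<tau>' F' where x: "x = (p, \<tau>, F)" "y = (p', \<tau>', F')" by (metis surj_pair)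
    obtain t t' where "1 \<le> t" "p \<in> strict_partitions n t" "\<tau> permutes {1..<t}" "F \<in> PiE {..<p ! 0} (columns b p)"
      "1 \<le> t'" "p' \<in> strict_partitions n t'" "\<tau>' permutes {1..<t'}" "F' \<in> PiE {..<p' ! 0} (columns b p')"
      using DE xy(1,2) unfolding x by meson
    then show "x = y" using filled_blocks_inj xy(3) unfolding x by blast
  qed
  then have "card D = card (filled_blocks ` D)" by (simp add: card_image)
  also have "\<dots> \<le> num_prime_patterns b n"
  proof (rule card_block_words_le[OF assms(1)], rule image_subsetI)
    fix x assume "x \<in> D"
    obtain p \<tau> F where x: "x = (p, \<tau>, F)" by (metis surj_pair)
    show "filled_blocks x \<in> block_words b n"
      using DE \<open>x \<in> D\<close> filled_blocks_in[OF assms(1)] unfolding x by meson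
  qed
  finally have card_D: "card D \<le> num_prime_patterns b n" .
  have finX: "finite (?X p)" for p
    by (intro finite_cartesian_product finite_PiE finite_columns finite_permutations) auto
  have card_X: "real (card (?X p)) = fact (t - 1) * real (card (PiE {..<p ! 0} (columns b p)))"
    if "p \<in> strict_partitions n t" for p t
    using that card_permutations[of "{1..<t}" "t - 1"]
    by (simp add: strict_partitions_def card_cartesian_product)
  have "card D = (\<Sum>p\<in>(\<Union>t\<in>{1..n}. strict_partitions n t). card (?X p))"
    unfolding D_def using finX finite_strict_partitions by (intro card_SigmaI) auto
  also have "\<dots> = (\<Sum>t = 1..n. \<Sum>p\<in>strict_partitions n t. card (?X p))"
  proof (rule sum.UNION_disjoint)
    show "\<forall>t\<in>{1..n}. \<forall>t'\<in>{1..n}. t \<noteq> t' \<longrightarrow> strict_partitions n t \<inter> strict_partitions n t' = {}"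
      by (auto simp: strict_partitions_def)
  qed (simp_all add: finite_strict_partitions)
  finally have "real (card D) = (\<Sum>t = 1..n. \<Sum>p\<in>strict_partitions n t. real (card (?X p)))"
    by simp
  moreover have "1 / real b *
    (\<Sum>t = 1..n. \<Sum>p\<in>strict_partitions n t.
       (real b - 1) ^ n / real ((t + b - 1) choose b) *
       (\<Prod>i = 1..t. ((real i + real b - 1) / (real i + real b - 2)) ^ (p ! (i - 1))))
    \<le> (\<Sum>t = 1..n. \<Sum>p\<in>strict_partitions n t. real (card (?X p)))"
    unfolding sum_distrib_left
  proof (intro sum_mono)
    fix t p assume t: "t \<in> {1..n}" and p: "p \<in> strict_partitions n t"
    show "1 / real b * ((real b - 1) ^ n / real ((t + b - 1) choose b) *
       (\<Prod>i = 1..t. ((real i + real b - 1) / (real i + real b - 2)) ^ (p ! (i - 1))))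
      \<le> real (card (?X p))"
      unfolding card_X[OF p] using t by (intro card_fillings[OF p _ assms(1)]) simp
  qed
  ultimately show ?thesis using card_D by linarith
qed

end
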